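(* Let $f\in H^1(\mathbb{R})$. Then $\{\tau_\lambda f\}_{\lambda\in\mathbb{R}}$ is complete in $H^1(\mathbb{R})$ if and only if its Fourier transform $\hat f$ never vanishes on $\mathbb{R}\setminus\{0\}$.
   Context: Functions are complex-valued. For $f \in L^1(\mathbb{R})$ the Fourier transform is $\hat f(\zeta)=\int_{\mathbb{R}} f(x)e^{ix\zeta}\,dx$. The Hilbert transform $Hf$ is the multiplier operator given by $\widehat{Hf}(\zeta)=-i\frac{\zeta}{|\zeta|}\hat f(\zeta)$. The real Hardy space is $H^1(\mathbb{R})=\{f\in L^1(\mathbb{R}) : Hf\in L^1(\mathbb{R})\}$ (that is, there is a function $Hf\in L^1(\mathbb{R})$ satisfying $\widehat{Hf}(\zeta)=-i\frac{\zeta}{|\zeta|}\hat f(\zeta)$ for $\zeta\neq 0$), with norm $\|f\|_{H^1}=\|f\|_{L^1}+\|Hf\|_{L^1}$. Translation: $\tau_\lambda f(\cdot)=f(\cdot-\lambda)$. A system is complete in $H^1(\mathbb{R})$ if its (complex) linear span is dense in $H^1(\mathbb{R})$. *)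

theory Defs
  imports "HOL-Analysis.Analysis"
begin

text \<open>
  Elements of \<open>L\<^sup>1(\<real>)\<close> and of the Hardy space are represented by functions rather than by
  almost-everywhere classes. Membership, Fourier transform, norms and completeness depend
  only on these classes, and the norms are seminorms vanishing exactly on the almost-everywhere
  zero functions.
\<close>

definition L1 :: "(real \<Rightarrow> complex) set" where
  "L1 = {f. integrable lebesgue f}"

definition L1_norm :: "(real \<Rightarrow> complex) \<Rightarrow> real" where
  "L1_norm f = (\<integral>x. norm (f x) \<partial>lebesgue)"

definition fourier :: "(real \<Rightarrow> complex) \<Rightarrow> real \<Rightarrow> complex" where
  "fourier f \<zeta> = (\<integral>x. f x * exp (\<i> * complex_of_real (x * \<zeta>)) \<partial>lebesgue)"

definition is_hilbert_transform :: "(real \<Rightarrow> complex) \<Rightarrow> (real \<Rightarrow> complex) \<Rightarrow> bool" where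
  "is_hilbert_transform f g \<longleftrightarrow> g \<in> L1 \<and>
     (\<forall>\<zeta>. \<zeta> \<noteq> 0 \<longrightarrow> fourier g \<zeta> = - \<i> * complex_of_real (\<zeta> / \<bar>\<zeta>\<bar>) * fourier f \<zeta>)"

definition H1 :: "(real \<Rightarrow> complex) set" where
  "H1 = {f \<in> L1. \<exists>g. is_hilbert_transform f g}"

text \<open>
  By injectivity of the Fourier transform on \<open>L\<^sup>1(\<real>)\<close>, the Hilbert transform of a function
  in \<open>H1\<close> is determined up to a null set, so the choice of representative made here does
  not affect its norm. Outside \<open>H1\<close> the value is unspecified.
\<close>

definition hilbert :: "(real \<Rightarrow> complex) \<Rightarrow> real \<Rightarrow> complex" where
  "hilbert f = (SOME g. is_hilbert_transform f g)"

definition H1_norm :: "(real \<Rightarrow> complex) \<Rightarrow> real" where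
  "H1_norm f = L1_norm f + L1_norm (hilbert f)"

definition translate :: "real \<Rightarrow> (real \<Rightarrow> complex) \<Rightarrow> real \<Rightarrow> complex" where
  "translate t f = (\<lambda>x. f (x - t))"

text \<open>
  The library constant \<open>span\<close> only allows real coefficients, and complex-valued functions are
  not an instance of its type class; this is the same construction with complex coefficients.
\<close>

definition complex_span :: "(real \<Rightarrow> complex) set \<Rightarrow> (real \<Rightarrow> complex) set" where
  "complex_span S = {(\<lambda>x. \<Sum>\<phi>\<in>T. c \<phi> * \<phi> x) | T c. finite T \<and> T \<subseteq> S}"

text \<open>
  A system is understood to lie in \<open>H1\<close>, hence so does its span, and \<open>H1_norm\<close> is only
  applied to members of \<open>H1\<close>.
\<close>

definition complete_in_H1 :: "(real \<Rightarrow> complex) set \<Rightarrow> bool" where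
  "complete_in_H1 S \<longleftrightarrow> S \<subseteq> H1 \<and>
     (\<forall>h\<in>H1. \<forall>\<epsilon>>0. \<exists>g\<in>complex_span S. H1_norm (\<lambda>x. h x - g x) < \<epsilon>)"

end

theory Submission
  imports Defs "HOL-Probability.Sinc_Integral"
begin

text \<open>
  Necessity: point evaluation of the Fourier transform at \<open>\<zeta> \<noteq> 0\<close> is continuous on the Hardy
  space and nonzero on a modulated Fejer kernel whose spectrum lies on one side of the origin.

  Sufficiency is Wiener's argument. The closed span of the translates contains all convolutions
  \<open>\<phi> * f\<close> with \<open>\<phi> \<in> L\<^sup>1\<close>. If \<open>V\<close> is a de la Vallee Poussin kernel of small bandwidth at the frequency
  \<open>s\<close>, then \<open>f * V\<close> is close to \<open>fourier f s * V\<close>; hence \<open>h - f * h / fourier f s\<close> has at most half the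
  norm of \<open>h\<close> whenever the spectrum of \<open>h\<close> lies where \<open>fourier V = 1\<close>, and iterating shows that \<open>h\<close> is
  in the closed span. The required bandwidth is uniform in \<open>s\<close> on compact subsets of
  \<open>\<real> - {0}\<close>, so a partition of unity into equally spaced triangles handles every \<open>h\<close> with
  spectrum in such a set. These are dense: the Fourier transforms of \<open>h\<close> and of its Hilbert
  transform are continuous and differ by the factor \<open>\<plusminus>\<i>\<close> on the two sides of \<open>0\<close>, so both vanish
  at \<open>0\<close>, and low frequencies can be cut off at small cost.
\<close>

subsection \<open>The norm and the Fourier transform on Borel functions\<close>

text \<open>Whatever is subtracted from \<open>h\<close> must be subtracted from its Hilbert
  transform with the same coefficients. The argument therefore runs on pairs \<open>h\<close>,
  \<open>h'\<close> tied only by \<open>fourier f' \<zeta> * fourier h \<zeta> = fourier f \<zeta> *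
  fourier h' \<zeta>\<close>. For two Hilbert pairs this holds at every frequency and mentions no
  sign; it survives multiplying both transforms by a common factor; and it gives
  \<open>conv h f'\<close> the transform \<open>fourier f \<zeta> * fourier h' \<zeta>\<close>, so
  that subtracting \<open>conv h f / z\<close> and \<open>conv h f' / z\<close> multiplies both
  components by the same \<open>1 - fourier f \<zeta> / z\<close>. The bandwidth is uniform because
  the frequency \<open>s\<close> enters the error only through factors of modulus 1; compactness
  serves only to bound \<open>fourier f\<close> away from 0. A single kernel generates all others:
  integer shifts of \<open>triangle\<close>, the transform of \<open>fejer\<close>, give both the
  partition of unity and the plateau of \<open>vallee_poussin\<close>. The definitions refer to
  Lebesgue measure; Fubini and affine substitutions are carried out for Borel functions on
  \<open>lborel\<close> and transferred at the end.\<close>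

lemma L1_norm_lborel:
  assumes "f \<in> borel_measurable borel"
  shows "L1_norm f = (\<integral>x. norm (f x) \<partial>lborel)"
  unfolding L1_norm_def using assms by (intro integral_completion) auto

lemma fourier_lborel:
  assumes [measurable]: "f \<in> borel_measurable borel"
  shows "fourier f \<zeta> = (\<integral>x. f x * exp (\<i> * complex_of_real (x * \<zeta>)) \<partial>lborel)"
  unfolding fourier_def by (intro integral_completion) auto

lemma borel_if_integrable:
  fixes f :: "real \<Rightarrow> complex"
  assumes "integrable lborel f"
  shows "f \<in> borel_measurable borel"
  using borel_measurable_integrable[OF assms] by simp

lemma norm_fourier_le:
  assumes "integrable lborel f"
  shows "norm (fourier f \<zeta>) \<le> L1_norm f"
proof -
  note [measurable] = borel_if_integrable[OF assms]
  have "norm (fourier f \<zeta>) \<le> (\<integral>x. norm (f x * exp (\<i> * complex_of_real (x * \<zeta>))) \<partial>lborel)"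
    by (simp only: fourier_lborel[OF borel_if_integrable[OF assms]] integral_norm_bound)
  also have "\<dots> = L1_norm f"
    by (simp add: L1_norm_lborel norm_mult)
  finally show ?thesis .
qed

lemma integrable_mult_exp:
  assumes "integrable lborel (f :: real \<Rightarrow> complex)"
  shows "integrable lborel (\<lambda>x. f x * exp (\<i> * complex_of_real (x * \<zeta>)))"
proof -
  note [measurable] = borel_if_integrable[OF assms]
  show ?thesis
    by (rule Bochner_Integration.integrable_bound[OF assms]) (auto simp: norm_mult)
qed

lemma fourier_add:
  assumes "integrable lborel f" "integrable lborel g"
  shows "fourier (\<lambda>x. f x + g x) \<zeta> = fourier f \<zeta> + fourier g \<zeta>"
  using assms[THEN integrable_mult_exp, of \<zeta>] assms[THEN borel_if_integrable]
  by (simp add: fourier_lborel borel_measurable_add distrib_right)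

lemma fourier_diff:
  assumes "integrable lborel f" "integrable lborel g"
  shows "fourier (\<lambda>x. f x - g x) \<zeta> = fourier f \<zeta> - fourier g \<zeta>"
  using assms[THEN integrable_mult_exp, of \<zeta>] assms[THEN borel_if_integrable]
  by (simp add: fourier_lborel borel_measurable_diff left_diff_distrib)

lemma fourier_cmult:
  assumes "integrable lborel f"
  shows "fourier (\<lambda>x. c * f x) \<zeta> = c * fourier f \<zeta>"
  using assms[THEN integrable_mult_exp, of \<zeta>] assms[THEN borel_if_integrable]
  by (simp add: fourier_lborel borel_measurable_times mult.assoc)

lemma fourier_sum:
  assumes "\<And>i. i \<in> I \<Longrightarrow> integrable lborel (f i)"
  shows "fourier (\<lambda>x. \<Sum>i\<in>I. f i x) \<zeta> = (\<Sum>i\<in>I. fourier (f i) \<zeta>)"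
  using assms
  by (induction I rule: infinite_finite_induct) (auto simp: fourier_add, simp_all add: fourier_def)

lemma L1_norm_nonneg [simp]: "0 \<le> L1_norm f"
  by (simp add: L1_norm_def)

lemma L1_norm_add_le:
  assumes "integrable lborel f" "integrable lborel g"
  shows "L1_norm (\<lambda>x. f x + g x) \<le> L1_norm f + L1_norm g"
proof -
  note [measurable] = assms[THEN borel_if_integrable]
  have "(\<integral>x. norm (f x + g x) \<partial>lborel) \<le> (\<integral>x. norm (f x) + norm (g x) \<partial>lborel)"
    using assms by (intro integral_mono) (auto intro: norm_triangle_ineq)
  also have "\<dots> = L1_norm f + L1_norm g"
    using assms by (simp add: L1_norm_lborel)
  finally show ?thesis by (simp add: L1_norm_lborel)
qed

lemma L1_norm_diff_le:
  assumes "integrable lborel f" "integrable lborel g"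
  shows "L1_norm (\<lambda>x. f x - g x) \<le> L1_norm f + L1_norm g"
proof -
  have "L1_norm (\<lambda>x. f x + - g x) \<le> L1_norm f + L1_norm (\<lambda>x. - g x)"
    using assms by (intro L1_norm_add_le) auto
  then show ?thesis by (simp add: L1_norm_def)
qed

lemma L1_norm_diff_triangle:
  assumes "integrable lborel f" "integrable lborel g" "integrable lborel h"
  shows "L1_norm (\<lambda>x. f x - h x) \<le> L1_norm (\<lambda>x. f x - g x) + L1_norm (\<lambda>x. g x - h x)"
  using L1_norm_add_le[of "\<lambda>x. f x - g x" "\<lambda>x. g x - h x"] assms by simp

lemma L1_norm_cmult: "L1_norm (\<lambda>x. c * f x) = norm c * L1_norm f"
  by (simp add: L1_norm_def norm_mult)

lemma L1_norm_cong_AE: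
  assumes "f \<in> borel_measurable borel" "g \<in> borel_measurable borel" "AE x in lborel. f x = g x"
  shows "L1_norm f = L1_norm g"
  using assms by (auto simp: L1_norm_lborel intro!: integral_cong_AE)

lemma integrable_translate:
  assumes "integrable lborel (f :: real \<Rightarrow> complex)"
  shows "integrable lborel (\<lambda>x. f (x - t))"
  using lborel_integrable_real_affine[OF assms, of 1 "-t"] by simp

lemma L1_norm_translate:
  assumes "integrable lborel f"
  shows "L1_norm (\<lambda>x. f (x - t)) = L1_norm f"
proof -
  note [measurable] = borel_if_integrable[OF assms]
  show ?thesis
    using lborel_integral_real_affine[of 1 "\<lambda>x. norm (f x)" "-t"] by (simp add: L1_norm_lborel)
qed

lemma fourier_translate:
  assumes "integrable lborel f"
  shows "fourier (\<lambda>x. f (x - t)) \<zeta> = exp (\<i> * complex_of_real (t * \<zeta>)) * fourier f \<zeta>"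
proof -
  note [measurable] = borel_if_integrable[OF assms]
  have "(\<integral>x. f x * exp (\<i> * complex_of_real (x * \<zeta>)) \<partial>lborel)
    = (\<integral>x. f (x - t) * exp (\<i> * complex_of_real ((x - t) * \<zeta>)) \<partial>lborel)"
    using lborel_integral_real_affine[of 1 "\<lambda>x. f x * exp (\<i> * complex_of_real (x * \<zeta>))" "-t"]
    by simp
  then have "exp (\<i> * complex_of_real (t * \<zeta>)) * fourier f \<zeta> =
    (\<integral>x. exp (\<i> * complex_of_real (t * \<zeta>)) * (f (x - t) * exp (\<i> * complex_of_real ((x - t) * \<zeta>))) \<partial>lborel)"
    by (simp add: fourier_lborel)
  also have "\<dots> = fourier (\<lambda>x. f (x - t)) \<zeta>"
    by (auto simp: fourier_lborel algebra_simps exp_add[symmetric] intro!: Bochner_Integration.integral_cong)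
  finally show ?thesis by simp
qed

text \<open>Dominated convergence with majorant \<open>norm (f x)\<close>. Continuity controls the
  excluded frequency 0 and yields a positive minimum of \<open>norm (fourier f \<zeta>)\<close> on
  compact sets avoiding it.\<close>

lemma continuous_fourier:
  assumes "integrable lborel f"
  shows "continuous_on UNIV (fourier f)"
proof -
  note [measurable] = borel_if_integrable[OF assms]
  have "continuous_on UNIV (\<lambda>\<zeta>. \<integral>x. f x * exp (\<i> * complex_of_real (x * \<zeta>)) \<partial>lborel)"
    unfolding continuous_on_sequentially o_def
  proof (intro allI ballI impI)
    fix z :: "nat \<Rightarrow> real" and a
    assume "(\<forall>n. z n \<in> UNIV) \<and> z \<longlonglongrightarrow> a"
    then show "(\<lambda>n. \<integral>x. f x * exp (\<i> * complex_of_real (x * z n)) \<partial>lborel)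
      \<longlonglongrightarrow> (\<integral>x. f x * exp (\<i> * complex_of_real (x * a)) \<partial>lborel)"
      using assms
      by (intro integral_dominated_convergence[where w = "\<lambda>x. norm (f x)"])
         (auto simp: norm_mult intro!: tendsto_intros)
  qed
  then show ?thesis by (simp add: fourier_lborel cong: continuous_on_cong)
qed

subsection \<open>Continuity of translation\<close>

lemma tendsto_L1_norm_0:
  assumes "g \<longlonglongrightarrow> 0" "\<And>n. L1_norm (f n) \<le> g n"
  shows "(\<lambda>n. L1_norm (f n)) \<longlonglongrightarrow> 0"
  by (rule tendsto_sandwich[OF always_eventually always_eventually tendsto_const assms(1)])
     (use assms(2) in auto)

text \<open>Sequential, to match dominated convergence, and a predicate, so that it can serve as the
  property in \<open>integrable_induct\<close>.\<close>

definition translation_continuous :: "(real \<Rightarrow> complex) \<Rightarrow> bool" where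
  "translation_continuous f \<longleftrightarrow>
     (\<forall>s. s \<longlonglongrightarrow> 0 \<longrightarrow> (\<lambda>n. L1_norm (\<lambda>x. f (x - s n) - f x)) \<longlonglongrightarrow> 0)"

text \<open>Translation is an isometry of L1, so the distance from \<open>f\<close> to
  \<open>g\<close> enters twice and the modulus of continuity of \<open>g\<close> once: three terms
  of size \<open>e/4\<close>.\<close>

lemma translation_continuous_approx:
  assumes f: "integrable lborel f"
    and g: "\<And>e. 0 < e \<Longrightarrow> \<exists>g. integrable lborel g \<and> translation_continuous g \<and> L1_norm (\<lambda>x. f x - g x) \<le> e"
  shows "translation_continuous f"
  unfolding translation_continuous_def
proof (intro allI impI LIMSEQ_I)
  fix s :: "nat \<Rightarrow> real" and e :: real
  assume s: "s \<longlonglongrightarrow> 0" and e: "0 < e"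
  then obtain g where gi: "integrable lborel g" and "translation_continuous g"
    and fg: "L1_norm (\<lambda>x. f x - g x) \<le> e/4"
    using g[of "e/4"] by auto
  with s have "(\<lambda>n. L1_norm (\<lambda>x. g (x - s n) - g x)) \<longlonglongrightarrow> 0"
    by (auto simp: translation_continuous_def)
  with e obtain N where N: "\<And>n. n \<ge> N \<Longrightarrow> L1_norm (\<lambda>x. g (x - s n) - g x) < e/4"
    using LIMSEQ_D[of _ 0 "e/4"] by fastforce
  have "L1_norm (\<lambda>x. f (x - s n) - f x) < e" if "n \<ge> N" for n
  proof -
    have "L1_norm (\<lambda>x. f (x - s n) - f x)
      \<le> L1_norm (\<lambda>x. f (x - s n) - g (x - s n)) + L1_norm (\<lambda>x. g (x - s n) - f x)"
      using f gi by (intro L1_norm_diff_triangle integrable_translate)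
    moreover have "L1_norm (\<lambda>x. g (x - s n) - f x)
      \<le> L1_norm (\<lambda>x. g (x - s n) - g x) + L1_norm (\<lambda>x. g x - f x)"
      using f gi by (intro L1_norm_diff_triangle integrable_translate)
    moreover have "L1_norm (\<lambda>x. f (x - s n) - g (x - s n)) = L1_norm (\<lambda>x. f x - g x)"
      using f gi by (intro L1_norm_translate[of "\<lambda>x. f x - g x"]) auto
    moreover have "L1_norm (\<lambda>x. g x - f x) = L1_norm (\<lambda>x. f x - g x)"
      by (simp add: L1_norm_def norm_minus_commute)
    ultimately show ?thesis using N[OF that] fg e by linarith
  qed
  then show "\<exists>N. \<forall>n\<ge>N. norm (L1_norm (\<lambda>x. f (x - s n) - f x) - 0) < e"
    by auto
qed

text \<open>For open \<open>U\<close>, the minimum of \<open>indicator U x\<close> and \<open>indicator U (x - s n)\<close> converges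
  pointwise to \<open>indicator U x\<close>, and \<open>\<bar>a - b\<bar> = a + b - 2 * min a b\<close>.\<close>
lemma translation_continuous_indicator_open:
  fixes U :: "real set"
  assumes U: "open U" and fin: "emeasure lborel U < \<infinity>"
  shows "translation_continuous (\<lambda>x. indicator U x *\<^sub>R c)"
  unfolding translation_continuous_def
proof (intro allI impI)
  fix s :: "nat \<Rightarrow> real"
  assume s: "s \<longlonglongrightarrow> 0"
  define I where "I = (indicator U :: real \<Rightarrow> real)"
  have [measurable]: "U \<in> sets borel" using U by auto
  have Im[measurable]: "I \<in> borel_measurable borel" by (simp add: I_def)
  have Ii: "integrable lborel I" using fin by (simp add: I_def integrable_real_indicator)
  have It: "integrable lborel (\<lambda>x. I (x - t))" for t
    using lborel_integrable_real_affine[OF Ii, of 1 "-t"] by simp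
  have It': "(\<integral>x. I (x - t) \<partial>lborel) = (\<integral>x. I x \<partial>lborel)" for t
    using lborel_integral_real_affine[of 1 I "-t"] by simp
  have "(\<lambda>n. min (I (x - s n)) (I x)) \<longlonglongrightarrow> I x" for x
  proof (cases "x \<in> U")
    case True
    have "(\<lambda>n. x - s n) \<longlonglongrightarrow> x - 0" by (intro tendsto_intros s)
    then have "\<forall>\<^sub>F n in sequentially. x - s n \<in> U"
      using U True by (auto dest: topological_tendstoD)
    then have "\<forall>\<^sub>F n in sequentially. min (I (x - s n)) (I x) = I x"
      by eventually_elim (use True in \<open>auto simp: I_def\<close>)
    then show ?thesis by (rule tendsto_eventually)
  next
    case False
    then have "min (I (x - s n)) (I x) = I x" for n by (auto simp: I_def indicator_def)
    then show ?thesis by simp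
  qed
  then have lim: "(\<lambda>n. \<integral>x. min (I (x - s n)) (I x) \<partial>lborel) \<longlonglongrightarrow> (\<integral>x. I x \<partial>lborel)"
    using Ii by (intro integral_dominated_convergence[where w = I]) (auto simp: I_def indicator_def)
  have mi: "integrable lborel (\<lambda>x. min (I (x - s n)) (I x))" for n
    by (rule Bochner_Integration.integrable_bound[OF Ii]) (auto simp: I_def indicator_def)
  have "L1_norm (\<lambda>x. indicator U (x - s n) *\<^sub>R c - indicator U x *\<^sub>R c)
    = norm c * (2 * (\<integral>x. I x \<partial>lborel) - 2 * (\<integral>x. min (I (x - s n)) (I x) \<partial>lborel))" for n
  proof -
    have "L1_norm (\<lambda>x. indicator U (x - s n) *\<^sub>R c - indicator U x *\<^sub>R c)
      = (\<integral>x. norm c * (I (x - s n) + I x - 2 * min (I (x - s n)) (I x)) \<partial>lborel)"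
      by (subst L1_norm_lborel, measurable, intro Bochner_Integration.integral_cong refl)
         (auto simp: I_def indicator_def)
    also have "\<dots> = norm c * ((\<integral>x. I (x - s n) \<partial>lborel) + (\<integral>x. I x \<partial>lborel)
        - 2 * (\<integral>x. min (I (x - s n)) (I x) \<partial>lborel))"
      using Ii It mi by simp
    finally show ?thesis by (simp add: It')
  qed
  moreover have "(\<lambda>n. norm c * (2 * (\<integral>x. I x \<partial>lborel) - 2 * (\<integral>x. min (I (x - s n)) (I x) \<partial>lborel)))
    \<longlonglongrightarrow> norm c * (2 * (\<integral>x. I x \<partial>lborel) - 2 * (\<integral>x. I x \<partial>lborel))"
    by (intro tendsto_intros lim)
  ultimately show "(\<lambda>n. L1_norm (\<lambda>x. indicator U (x - s n) *\<^sub>R c - indicator U x *\<^sub>R c)) \<longlonglongrightarrow> 0"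
    by simp
qed

text \<open>Outer regularity reduces the indicator of a Borel set of finite measure to that of an
  open superset; the limit case is dominated convergence followed by the approximation
  lemma.\<close>

lemma translation_continuous_integrable:
  fixes f :: "real \<Rightarrow> complex"
  assumes "integrable lborel f"
  shows "translation_continuous f"
  using assms
proof (induction rule: integrable_induct)
  case (base A c)
  have [measurable]: "A \<in> sets borel" using base by simp
  have Ai: "integrable lborel (\<lambda>x. indicator A x *\<^sub>R c)"
    using base by (intro integrable_scaleR_left integrable_real_indicator) auto
  show ?case
  proof (rule translation_continuous_approx[OF Ai])
    fix e :: real assume e: "0 < e"
    \<comment> \<open>The \<open>+ 1\<close> keeps the denominator positive when
      \<open>c = 0\<close>.\<close>
    define d where "d = e / (norm c + 1)"
    have d: "0 < d" using e by (simp add: d_def add_nonneg_pos)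
    obtain U where U: "open U" "A \<subseteq> U" "emeasure lborel (U - A) \<le> d"
      using outer_regular_lborel_le[OF _ d, of A] by auto
    have [measurable]: "U \<in> sets borel" using U by auto
    have "emeasure lborel U = emeasure lborel A + emeasure lborel (U - A)"
      using U by (subst plus_emeasure) (auto simp: Un_absorb1)
    also have "\<dots> < \<infinity>"
      using base U(3) by (auto simp: ennreal_add_eq_top less_top[symmetric] dest: le_less_trans[OF _ ennreal_less_top])
    finally have Uf: "emeasure lborel U < \<infinity>" .
    have "L1_norm (\<lambda>x. indicator A x *\<^sub>R c - indicator U x *\<^sub>R c) = (\<integral>x. norm c * indicator (U - A) x \<partial>lborel)"
      using U(2) by (subst L1_norm_lborel, measurable, intro Bochner_Integration.integral_cong refl)
         (auto simp: indicator_def)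
    also have "\<dots> = norm c * measure lborel (U - A)" by simp
    also have "\<dots> \<le> norm c * d"
      using U(3) d by (intro mult_left_mono) (auto simp: measure_def intro!: enn2real_leI)
    also have "\<dots> \<le> (norm c + 1) * d" using d by simp
    also have "\<dots> = e"
    proof -
      have "norm c + 1 \<noteq> 0" using norm_ge_zero[of c] by linarith
      then show ?thesis unfolding d_def by (rule nonzero_mult_div_cancel_left[of _ e, folded times_divide_eq_right])
    qed
    finally have "L1_norm (\<lambda>x. indicator A x *\<^sub>R c - indicator U x *\<^sub>R c) \<le> e" .
    moreover have "integrable lborel (\<lambda>x. indicator U x *\<^sub>R c)"
      using Uf by (intro integrable_scaleR_left integrable_real_indicator) auto
    ultimately show "\<exists>g. integrable lborel g \<and> translation_continuous g \<and> L1_norm (\<lambda>x. indicator A x *\<^sub>R c - g x) \<le> e"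
      using translation_continuous_indicator_open[OF U(1) Uf, of c] by blast
  qed
next
  case (add f g)
  show ?case
    unfolding translation_continuous_def
  proof (intro allI impI)
    fix s :: "nat \<Rightarrow> real" assume s: "s \<longlonglongrightarrow> 0"
    have "(\<lambda>n. L1_norm (\<lambda>x. f (x - s n) - f x) + L1_norm (\<lambda>x. g (x - s n) - g x)) \<longlonglongrightarrow> 0 + 0"
      using add s by (intro tendsto_add) (auto simp: translation_continuous_def)
    then have "(\<lambda>n. L1_norm (\<lambda>x. f (x - s n) - f x) + L1_norm (\<lambda>x. g (x - s n) - g x)) \<longlonglongrightarrow> 0"
      by simp
    then show "(\<lambda>n. L1_norm (\<lambda>x. f (x - s n) + g (x - s n) - (f x + g x))) \<longlonglongrightarrow> 0"
    proof (rule tendsto_L1_norm_0)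
      show "L1_norm (\<lambda>x. f (x - s n) + g (x - s n) - (f x + g x))
        \<le> L1_norm (\<lambda>x. f (x - s n) - f x) + L1_norm (\<lambda>x. g (x - s n) - g x)" for n
        using L1_norm_add_le[of "\<lambda>x. f (x - s n) - f x" "\<lambda>x. g (x - s n) - g x"] add
        by (simp add: integrable_translate add_diff_add)
    qed
  qed
next
  case (lim f s)
  have si: "\<And>i. integrable lborel (s i)" and fi: "integrable lborel f"
    and st: "\<And>i. translation_continuous (s i)"
    and sl: "\<And>x. (\<lambda>i. s i x) \<longlonglongrightarrow> f x"
    and sb: "\<And>i x. norm (s i x) \<le> 2 * norm (f x)"
    using lim by auto
  note [measurable] = si[THEN borel_if_integrable] fi[THEN borel_if_integrable]
  show ?case
  proof (rule translation_continuous_approx[OF fi])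
    fix e :: real assume e: "0 < e"
    have "(\<lambda>i. \<integral>x. norm (f x - s i x) \<partial>lborel) \<longlonglongrightarrow> (\<integral>x. 0 \<partial>(lborel :: real measure))"
    \<comment> \<open>3 = 1 + 2, as \<open>norm (s i x)\<close> is at most
      \<open>2 * norm (f x)\<close>.\<close>
    proof (rule integral_dominated_convergence[where w = "\<lambda>x. 3 * norm (f x)"])
      show "AE x in lborel. (\<lambda>i. norm (f x - s i x)) \<longlonglongrightarrow> 0"
      proof (rule AE_I2)
        fix x :: real assume "x \<in> space lborel"
        then have "(\<lambda>i. f x - s i x) \<longlonglongrightarrow> f x - f x"
          by (intro tendsto_diff tendsto_const sl)
        then show "(\<lambda>i. norm (f x - s i x)) \<longlonglongrightarrow> 0"
          by (simp add: tendsto_norm_zero_iff)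
      qed
      show "AE x in lborel. norm (norm (f x - s i x)) \<le> 3 * norm (f x)" for i
      proof (rule AE_I2)
        fix x :: real assume "x \<in> space lborel"
        from sb[of i x] show "norm (norm (f x - s i x)) \<le> 3 * norm (f x)"
          using norm_triangle_ineq4[of "f x" "s i x"] by simp
      qed
      show "integrable lborel (\<lambda>x. 3 * norm (f x))" using fi by simp
    qed measurable
    then have "(\<lambda>i. L1_norm (\<lambda>x. f x - s i x)) \<longlonglongrightarrow> 0" by (simp add: L1_norm_lborel)
    with e obtain i where "L1_norm (\<lambda>x. f x - s i x) < e"
      using LIMSEQ_D[of _ 0 e] by fastforce
    then show "\<exists>g. integrable lborel g \<and> translation_continuous g \<and> L1_norm (\<lambda>x. f x - g x) \<le> e"
      using si[of i] st[of i] less_imp_le by blast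
  qed
qed

lemma tendsto_L1_translate:
  assumes "integrable lborel f" "s \<longlonglongrightarrow> 0"
  shows "(\<lambda>n. L1_norm (\<lambda>x. f (x - s n) - f x)) \<longlonglongrightarrow> 0"
  using translation_continuous_integrable[OF assms(1)] assms(2)
  by (simp add: translation_continuous_def)

subsection \<open>Minkowski's integral inequality\<close>

context
  fixes \<phi> :: "real \<Rightarrow> complex" and B :: "real \<Rightarrow> real \<Rightarrow> complex" and C :: real
  assumes \<phi>: "integrable lborel \<phi>"
    and B [measurable]: "case_prod B \<in> borel_measurable (borel \<Otimes>\<^sub>M borel)"
    and Bi: "\<And>y. integrable lborel (\<lambda>x. B x y)"
    and BC: "\<And>y. L1_norm (\<lambda>x. B x y) \<le> C"
begin

lemma borel_measurable_L1_norm_snd: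
  "(\<lambda>y. L1_norm (\<lambda>x. B x y)) \<in> borel_measurable borel"
proof -
  have "(\<lambda>y. \<integral>x. norm (B x y) \<partial>lborel) \<in> borel_measurable borel"
    by measurable
  then show ?thesis by (simp add: L1_norm_lborel borel_if_integrable[OF Bi])
qed

lemma integrable_norm_times_L1_norm:
  "integrable lborel (\<lambda>y. norm (\<phi> y) * L1_norm (\<lambda>x. B x y))"
proof (rule Bochner_Integration.integrable_bound)
  show "integrable lborel (\<lambda>y. norm (\<phi> y) * C)" using \<phi> by auto
  show "(\<lambda>y. norm (\<phi> y) * L1_norm (\<lambda>x. B x y)) \<in> borel_measurable lborel"
    using borel_if_integrable[OF \<phi>] borel_measurable_L1_norm_snd by measurable
  show "AE x in lborel. norm (norm (\<phi> x) * L1_norm (\<lambda>xa. B xa x)) \<le> norm (norm (\<phi> x) * C)"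
    using order_trans[OF L1_norm_nonneg BC] by (auto simp: abs_mult intro!: mult_left_mono BC)
qed

text \<open>The bound \<open>C\<close>, uniform in the parameter \<open>y\<close>, makes the
  iterated integral of the absolute value finite, which licenses Fubini for all kernels
  below.\<close>

lemma integrable_kernel: "integrable (lborel \<Otimes>\<^sub>M lborel) (\<lambda>(y, x). \<phi> y * B x y)"
proof (rule lborel_pair.Fubini_integrable)
  note [measurable] = borel_if_integrable[OF \<phi>]
  show "(\<lambda>(y, x). \<phi> y * B x y) \<in> borel_measurable (lborel \<Otimes>\<^sub>M lborel)"
    by measurable
  have "(\<integral>x. norm (\<phi> y * B x y) \<partial>lborel) = norm (\<phi> y) * L1_norm (\<lambda>x. B x y)" for y
    by (simp add: norm_mult L1_norm_lborel borel_if_integrable[OF Bi])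
  then show "integrable lborel (\<lambda>x. LINT y|lborel. norm (case (x, y) of (y, x) \<Rightarrow> \<phi> y * B x y))"
    using integrable_norm_times_L1_norm by simp
  show "AE x in lborel. integrable lborel (\<lambda>y. case (x, y) of (y, x) \<Rightarrow> \<phi> y * B x y)"
    using Bi by simp
qed

lemma AE_integrable_kernel: "AE x in lborel. integrable lborel (\<lambda>y. \<phi> y * B x y)"
  using lborel_pair.AE_integrable_snd[OF integrable_kernel] .

lemma integrable_integral_kernel: "integrable lborel (\<lambda>x. \<integral>y. \<phi> y * B x y \<partial>lborel)"
  using lborel_pair.integrable_snd[OF integrable_kernel] .

text \<open>Move the norm inside and exchange the integrals. With \<open>B\<close> a translate this
  is Young's inequality; with \<open>B\<close> a difference of translates it gives the approximation
  errors.\<close>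

lemma L1_norm_integral_kernel_le:
  "L1_norm (\<lambda>x. \<integral>y. \<phi> y * B x y \<partial>lborel) \<le> (\<integral>y. norm (\<phi> y) * L1_norm (\<lambda>x. B x y) \<partial>lborel)"
proof -
  have n: "integrable (lborel \<Otimes>\<^sub>M lborel) (\<lambda>(y, x). norm (\<phi> y * B x y))"
    using integrable_norm[OF integrable_kernel] by (simp add: case_prod_beta')
  have "L1_norm (\<lambda>x. \<integral>y. \<phi> y * B x y \<partial>lborel)
    \<le> (\<integral>x. \<integral>y. norm (\<phi> y * B x y) \<partial>lborel \<partial>lborel)"
    unfolding L1_norm_lborel[OF borel_if_integrable[OF integrable_integral_kernel]]
    using integrable_integral_kernel lborel_pair.integrable_snd[OF n]
    by (intro integral_mono) (auto intro: integral_norm_bound)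
  also have "\<dots> = (\<integral>y. \<integral>x. norm (\<phi> y * B x y) \<partial>lborel \<partial>lborel)"
    using lborel_pair.Fubini_integral[OF n] by simp
  also have "\<dots> = (\<integral>y. norm (\<phi> y) * L1_norm (\<lambda>x. B x y) \<partial>lborel)"
    by (simp add: norm_mult L1_norm_lborel borel_if_integrable[OF Bi])
  finally show ?thesis .
qed

end

text \<open>Dominated convergence in the parameter, with majorant
  \<open>norm (\<phi> y) * C\<close>: decay for each fixed \<open>y\<close>, typically from
  continuity of translation, suffices.\<close>

lemma tendsto_integral_L1_norm_kernel:
  fixes \<phi> :: "real \<Rightarrow> complex" and B :: "nat \<Rightarrow> real \<Rightarrow> real \<Rightarrow> complex"
  assumes \<phi>: "integrable lborel \<phi>"
    and B: "\<And>n. case_prod (B n) \<in> borel_measurable (borel \<Otimes>\<^sub>M borel)"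
    and Bi: "\<And>n y. integrable lborel (\<lambda>x. B n x y)"
    and BC: "\<And>n y. L1_norm (\<lambda>x. B n x y) \<le> C"
    and lim: "\<And>y. (\<lambda>n. L1_norm (\<lambda>x. B n x y)) \<longlonglongrightarrow> 0"
  shows "(\<lambda>n. \<integral>y. norm (\<phi> y) * L1_norm (\<lambda>x. B n x y) \<partial>lborel) \<longlonglongrightarrow> 0"
proof -
  have "(\<lambda>n. \<integral>y. norm (\<phi> y) * L1_norm (\<lambda>x. B n x y) \<partial>lborel) \<longlonglongrightarrow> (\<integral>y. 0 \<partial>(lborel :: real measure))"
  proof (rule integral_dominated_convergence[where w = "\<lambda>y. norm (\<phi> y) * C"])
    show "AE x in lborel. (\<lambda>i. norm (\<phi> x) * L1_norm (\<lambda>xa. B i xa x)) \<longlonglongrightarrow> 0"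
      using lim by (auto intro!: AE_I2 tendsto_mult_right_zero)
    show "AE x in lborel. norm (norm (\<phi> x) * L1_norm (\<lambda>xa. B i xa x)) \<le> norm (\<phi> x) * C" for i
      using BC by (auto simp: abs_mult intro!: mult_left_mono)
    show "(\<lambda>x. norm (\<phi> x) * L1_norm (\<lambda>xa. B i xa x)) \<in> borel_measurable lborel" for i
      using borel_measurable_integrable[OF integrable_norm_times_L1_norm[OF \<phi> B Bi BC]] .
  qed (use \<phi> in auto)
  then show ?thesis by simp
qed

subsection \<open>Convolution and dilated kernels\<close>

text \<open>Where the integrand is not integrable the value defaults to 0; for integrable arguments
  this concerns only a null set of \<open>x\<close>, which is why identities below hold almost
  everywhere.\<close>

definition conv :: "(real \<Rightarrow> complex) \<Rightarrow> (real \<Rightarrow> complex) \<Rightarrow> real \<Rightarrow> complex" where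
  "conv \<phi> u x = (\<integral>y. \<phi> y * u (x - y) \<partial>lborel)"

lemma borel_measurable_shift:
  assumes "(u :: real \<Rightarrow> complex) \<in> borel_measurable borel"
  shows "(\<lambda>(x, y). u (x - y)) \<in> borel_measurable (borel \<Otimes>\<^sub>M borel)"
  using assms by measurable

context
  fixes \<phi> u :: "real \<Rightarrow> complex"
  assumes \<phi>: "integrable lborel \<phi>" and u: "integrable lborel u"
begin

lemma integrable_conv: "integrable lborel (conv \<phi> u)"
  unfolding conv_def
  by (rule integrable_integral_kernel[OF \<phi> borel_measurable_shift[OF borel_if_integrable[OF u]]
        integrable_translate[OF u] eq_refl[OF L1_norm_translate[OF u]]])

lemma AE_integrable_conv: "AE x in lborel. integrable lborel (\<lambda>y. \<phi> y * u (x - y))"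
  by (rule AE_integrable_kernel[OF \<phi> borel_measurable_shift[OF borel_if_integrable[OF u]]
        integrable_translate[OF u] eq_refl[OF L1_norm_translate[OF u]]])

lemma L1_norm_conv_le: "L1_norm (conv \<phi> u) \<le> L1_norm \<phi> * L1_norm u"
proof -
  have "L1_norm (conv \<phi> u) \<le> (\<integral>y. norm (\<phi> y) * L1_norm (\<lambda>x. u (x - y)) \<partial>lborel)"
    unfolding conv_def
    by (rule L1_norm_integral_kernel_le[OF \<phi> borel_measurable_shift[OF borel_if_integrable[OF u]]
        integrable_translate[OF u] eq_refl[OF L1_norm_translate[OF u]]])
  then show ?thesis
    by (simp add: L1_norm_translate[OF u] L1_norm_lborel[OF borel_if_integrable[OF \<phi>]])
qed

text \<open>The exponential is absorbed into the kernel \<open>?B\<close>, so that Fubini applies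
  and the inner integral is the transform of a translate of \<open>u\<close>.\<close>

lemma fourier_conv: "fourier (conv \<phi> u) \<zeta> = fourier \<phi> \<zeta> * fourier u \<zeta>"
proof -
  let ?B = "\<lambda>x y. u (x - y) * exp (\<i> * complex_of_real (x * \<zeta>))"
  note [measurable] = borel_if_integrable[OF \<phi>] borel_if_integrable[OF u]
  have B: "case_prod ?B \<in> borel_measurable (borel \<Otimes>\<^sub>M borel)" by measurable
  have Bi: "integrable lborel (\<lambda>x. ?B x y)" for y
    using integrable_mult_exp[OF integrable_translate[OF u]] .
  have "L1_norm (\<lambda>x. ?B x y) = L1_norm (\<lambda>x. u (x - y))" for y
    by (simp add: L1_norm_def norm_mult)
  then have BC: "L1_norm (\<lambda>x. ?B x y) \<le> L1_norm u" for y
    by (simp add: L1_norm_translate[OF u])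
  have "fourier (conv \<phi> u) \<zeta> = (\<integral>x. \<integral>y. \<phi> y * ?B x y \<partial>lborel \<partial>lborel)"
    unfolding fourier_lborel[OF borel_if_integrable[OF integrable_conv]] conv_def
    by (simp flip: integral_mult_left_zero add: mult.assoc)
  also have "\<dots> = (\<integral>y. \<integral>x. \<phi> y * ?B x y \<partial>lborel \<partial>lborel)"
    by (rule lborel_pair.Fubini_integral[OF integrable_kernel[OF \<phi> B Bi BC]])
  also have "\<dots> = (\<integral>y. \<phi> y * fourier (\<lambda>x. u (x - y)) \<zeta> \<partial>lborel)"
    by (simp add: fourier_lborel)
  also have "\<dots> = fourier \<phi> \<zeta> * fourier u \<zeta>"
    by (simp add: fourier_translate[OF u] fourier_lborel[of \<phi>] flip: mult.assoc)
  finally show ?thesis .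
qed

end

text \<open>\<open>a\<close> is the bandwidth and \<open>s\<close> the centre frequency. The factor
  \<open>a\<close> makes the L1 norm independent of both; the minus sign fits the sign convention of
  \<open>fourier\<close> and moves the spectrum to \<open>+ s\<close>.\<close>

definition dilate :: "real \<Rightarrow> real \<Rightarrow> (real \<Rightarrow> complex) \<Rightarrow> real \<Rightarrow> complex" where
  "dilate a s K x = a * K (a * x) * exp (- (\<i> * complex_of_real (x * s)))"

lemma dilate_measurable [measurable (raw)]:
  assumes [measurable]: "K \<in> borel_measurable borel"
  shows "dilate a s K \<in> borel_measurable borel"
  unfolding dilate_def[abs_def] by measurable

context
  fixes a s :: real and K :: "real \<Rightarrow> complex"
  assumes a: "0 < a" and K: "integrable lborel K"
begin

lemma integrable_dilate: "integrable lborel (dilate a s K)"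
proof -
  note [measurable] = borel_if_integrable[OF K]
  have "integrable lborel (\<lambda>x. complex_of_real a * K (a * x))"
    using lborel_integrable_real_affine[OF K, of a 0] a by simp
  then show ?thesis
    by (rule Bochner_Integration.integrable_bound)
       (auto simp: dilate_def norm_mult exp_minus norm_inverse)
qed

lemma L1_norm_dilate: "L1_norm (dilate a s K) = L1_norm K"
proof -
  note [measurable] = borel_if_integrable[OF K] borel_if_integrable[OF integrable_dilate]
  have "L1_norm (dilate a s K) = (\<integral>x. a * norm (K (a * x)) \<partial>lborel)"
    using a by (subst L1_norm_lborel) (auto simp: dilate_def norm_mult exp_minus norm_inverse)
  also have "\<dots> = L1_norm K"
    using lborel_integral_real_affine[of a "\<lambda>x. norm (K x)" 0] a by (simp add: L1_norm_lborel)
  finally show ?thesis .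
qed

lemma fourier_dilate: "fourier (dilate a s K) \<zeta> = fourier K ((\<zeta> - s) / a)"
proof -
  note [measurable] = borel_if_integrable[OF K] borel_if_integrable[OF integrable_dilate]
  have "fourier K ((\<zeta> - s) / a)
    = a *\<^sub>R (\<integral>x. K (a * x) * exp (\<i> * complex_of_real (a * x * ((\<zeta> - s) / a))) \<partial>lborel)"
    using lborel_integral_real_affine[of a "\<lambda>x. K x * exp (\<i> * complex_of_real (x * ((\<zeta> - s) / a)))" 0] a
    by (simp add: fourier_lborel)
  also have "\<dots> = (\<integral>x. a * (K (a * x) * exp (\<i> * complex_of_real (a * x * ((\<zeta> - s) / a)))) \<partial>lborel)"
    by (simp add: scaleR_conv_of_real)
  also have "\<dots> = fourier (dilate a s K) \<zeta>"
    unfolding fourier_lborel[OF borel_if_integrable[OF integrable_dilate]]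
  proof (rule Bochner_Integration.integral_cong[OF refl])
    fix x
    have "a * x * ((\<zeta> - s) / a) = x * \<zeta> - x * s"
      using a by (simp add: field_simps)
    then have "exp (\<i> * complex_of_real (a * x * ((\<zeta> - s) / a)))
      = exp (- (\<i> * complex_of_real (x * s))) * exp (\<i> * complex_of_real (x * \<zeta>))"
      unfolding exp_add[symmetric] by (simp only:) (simp add: algebra_simps)
    then show "a * (K (a * x) * exp (\<i> * complex_of_real (a * x * ((\<zeta> - s) / a))))
      = dilate a s K x * exp (\<i> * complex_of_real (x * \<zeta>))"
      by (simp add: dilate_def)
  qed
  finally show ?thesis ..
qed

end

lemma conv_dilate_0:
  assumes a: "0 < a"
    and [measurable]: "K \<in> borel_measurable borel" "u \<in> borel_measurable borel"
  shows "conv (dilate a 0 K) u x = (\<integral>z. K z * u (x - z / a) \<partial>lborel)"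
  using lborel_integral_real_affine[of a "\<lambda>z. K z * u (x - z / a)" 0] a
  by (simp add: conv_def dilate_def mult.assoc scaleR_conv_of_real)

text \<open>After substitution the difference is the integral of \<open>K z\<close> times
  \<open>u (x - z / a) - u x\<close>; Minkowski and continuity of translation finish.
  \<open>K\<close> has arbitrary mass, hence the factor \<open>fourier K 0\<close>.\<close>

lemma approximate_identity:
  assumes K: "integrable lborel K" and u: "integrable lborel u"
  shows "(\<lambda>n. L1_norm (\<lambda>x. conv (dilate (real (Suc n)) 0 K) u x - fourier K 0 * u x)) \<longlonglongrightarrow> 0"
proof -
  note [measurable] = borel_if_integrable[OF K] borel_if_integrable[OF u]
  \<comment> \<open>Kept apart from \<open>B\<close> because integrability of
    \<open>K z * A n x z\<close> in \<open>z\<close>, for almost every \<open>x\<close>, is what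
    permits splitting the integral of the difference.\<close>
  define A where "A n x z = u (x - z / real (Suc n))" for n :: nat and x z :: real
  define B where "B n x z = A n x z - u x" for n :: nat and x z :: real
  have A: "case_prod (A n) \<in> borel_measurable (borel \<Otimes>\<^sub>M borel)" for n
    unfolding A_def by measurable
  have Ai: "integrable lborel (\<lambda>x. A n x z)" for n z
    unfolding A_def by (rule integrable_translate[OF u])
  have AC: "L1_norm (\<lambda>x. A n x z) \<le> L1_norm u" for n z
    unfolding A_def by (simp only: L1_norm_translate[OF u])
  have B: "case_prod (B n) \<in> borel_measurable (borel \<Otimes>\<^sub>M borel)" for n
    unfolding B_def A_def by measurable
  have Bi: "integrable lborel (\<lambda>x. B n x z)" for n z
    unfolding B_def using Ai u by auto
  have BC: "L1_norm (\<lambda>x. B n x z) \<le> 2 * L1_norm u" for n z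
    unfolding B_def using L1_norm_diff_le[OF Ai u, of n z] AC[of n z] by simp
  have "(\<lambda>n. L1_norm (\<lambda>x. B n x z)) \<longlonglongrightarrow> 0" for z
  proof -
    have "(\<lambda>n. z * inverse (real (Suc n))) \<longlonglongrightarrow> z * 0"
      by (intro tendsto_mult tendsto_const LIMSEQ_inverse_real_of_nat)
    then have "(\<lambda>n. z / real (Suc n)) \<longlonglongrightarrow> 0" by (simp add: divide_inverse)
    then show ?thesis unfolding B_def A_def by (rule tendsto_L1_translate[OF u])
  qed
  then have lim: "(\<lambda>n. \<integral>z. norm (K z) * L1_norm (\<lambda>x. B n x z) \<partial>lborel) \<longlonglongrightarrow> 0"
    by (intro tendsto_integral_L1_norm_kernel[OF K B Bi BC])
  have "L1_norm (\<lambda>x. conv (dilate (real (Suc n)) 0 K) u x - fourier K 0 * u x)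
    \<le> (\<integral>z. norm (K z) * L1_norm (\<lambda>x. B n x z) \<partial>lborel)" for n
  proof -
    have "AE x in lborel. conv (dilate (real (Suc n)) 0 K) u x - fourier K 0 * u x = (\<integral>z. K z * B n x z \<partial>lborel)"
      using AE_integrable_kernel[OF K A Ai AC, of n]
    proof eventually_elim
      case (elim x)
      have "integrable lborel (\<lambda>z. K z * u x)" using K by simp
      with elim have "(\<integral>z. K z * B n x z \<partial>lborel) = (\<integral>z. K z * A n x z \<partial>lborel) - (\<integral>z. K z * u x \<partial>lborel)"
        by (simp add: B_def right_diff_distrib)
      also have "(\<integral>z. K z * A n x z \<partial>lborel) = conv (dilate (real (Suc n)) 0 K) u x"
        by (subst conv_dilate_0) (auto simp: A_def)
      also have "(\<integral>z. K z * u x \<partial>lborel) = fourier K 0 * u x"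
        by (simp add: fourier_lborel)
      finally show ?case by simp
    qed
    then have "L1_norm (\<lambda>x. conv (dilate (real (Suc n)) 0 K) u x - fourier K 0 * u x)
      = L1_norm (\<lambda>x. \<integral>z. K z * B n x z \<partial>lborel)"
      using integrable_conv[OF integrable_dilate[OF _ K] u, of "real (Suc n)" 0] u
        integrable_integral_kernel[OF K B Bi BC]
      by (intro L1_norm_cong_AE borel_if_integrable) auto
    then show ?thesis using L1_norm_integral_kernel_le[OF K B Bi BC] by simp
  qed
  then show ?thesis by (rule tendsto_L1_norm_0[OF lim])
qed

text \<open>No centre frequency occurs here: this is the source of the uniform bandwidth.\<close>

definition spread_error :: "(real \<Rightarrow> complex) \<Rightarrow> (real \<Rightarrow> complex) \<Rightarrow> real \<Rightarrow> real" where
  "spread_error f K a = (\<integral>y. norm (f y) * L1_norm (\<lambda>x. K (x - a * y) - K x) \<partial>lborel)"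

lemma tendsto_spread_error:
  assumes f: "integrable lborel f" and K: "integrable lborel K"
  shows "(\<lambda>n. spread_error f K (inverse (real (Suc n)))) \<longlonglongrightarrow> 0"
  unfolding spread_error_def
proof (rule tendsto_integral_L1_norm_kernel[OF f])
  note [measurable] = borel_if_integrable[OF K]
  show "(\<lambda>(x, y). K (x - inverse (real (Suc n)) * y) - K x) \<in> borel_measurable (borel \<Otimes>\<^sub>M borel)" for n
    by measurable
  show "integrable lborel (\<lambda>x. K (x - inverse (real (Suc n)) * y) - K x)" for n y
    using integrable_translate[OF K] K by auto
  show "L1_norm (\<lambda>x. K (x - inverse (real (Suc n)) * y) - K x) \<le> L1_norm K + L1_norm K" for n y
    using L1_norm_diff_le[OF integrable_translate[OF K] K] by (simp only: L1_norm_translate[OF K])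
  show "(\<lambda>n. L1_norm (\<lambda>x. K (x - inverse (real (Suc n)) * y) - K x)) \<longlonglongrightarrow> 0" for y
  proof (rule tendsto_L1_translate[OF K])
    have "(\<lambda>n. inverse (real (Suc n)) * y) \<longlonglongrightarrow> 0 * y"
      by (intro tendsto_mult tendsto_const LIMSEQ_inverse_real_of_nat)
    then show "(\<lambda>n. inverse (real (Suc n)) * y) \<longlonglongrightarrow> 0" by simp
  qed
qed

text \<open>Convolving with a kernel of small bandwidth around the frequency \<open>s\<close> almost acts as
  multiplication by \<open>fourier f s\<close>, uniformly in \<open>s\<close>.\<close>
lemma L1_norm_conv_dilate_le:
  assumes a: "0 < a" and f: "integrable lborel f" and K: "integrable lborel K"
  shows "L1_norm (\<lambda>x. conv f (dilate a s K) x - fourier f s * dilate a s K x) \<le> spread_error f K a"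
proof -
  define B where "B x y = dilate a s K (x - y) - exp (\<i> * complex_of_real (y * s)) * dilate a s K x" for x y
  note D = integrable_dilate[OF a K, of s]
  note [measurable] = borel_if_integrable[OF K] borel_if_integrable[OF f] borel_if_integrable[OF D]
  have B: "case_prod B \<in> borel_measurable (borel \<Otimes>\<^sub>M borel)"
    unfolding B_def by measurable
  have Bi: "integrable lborel (\<lambda>x. B x y)" for y
    unfolding B_def using D integrable_translate[OF D] by auto
  have BN: "L1_norm (\<lambda>x. B x y) = L1_norm (\<lambda>x. K (x - a * y) - K x)" for y
  proof -
    \<comment> \<open>Pulling out the phase leaves the same modulation on both terms, so
      \<open>s\<close> disappears from the norm.\<close>
    have "B x y = exp (\<i> * complex_of_real (y * s)) * dilate a s (\<lambda>x. K (x - a * y) - K x) x" for x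
    proof -
      have "exp (- (\<i> * complex_of_real ((x - y) * s)))
        = exp (\<i> * complex_of_real (y * s)) * exp (- (\<i> * complex_of_real (x * s)))"
        unfolding exp_add[symmetric] by (simp add: algebra_simps)
      then show ?thesis by (simp add: B_def dilate_def algebra_simps)
    qed
    then show ?thesis
      using L1_norm_dilate[OF a, of "\<lambda>x. K (x - a * y) - K x" s] K integrable_translate[OF K]
      by (simp add: L1_norm_cmult)
  qed
  have BC: "L1_norm (\<lambda>x. B x y) \<le> L1_norm K + L1_norm K" for y
    using L1_norm_diff_le[OF integrable_translate[OF K] K] by (simp only: BN L1_norm_translate[OF K])
  have "AE x in lborel. conv f (dilate a s K) x - fourier f s * dilate a s K x = (\<integral>y. f y * B x y \<partial>lborel)"
    using AE_integrable_conv[OF f D]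
  proof eventually_elim
    case (elim x)
    have "integrable lborel (\<lambda>y. f y * exp (\<i> * complex_of_real (y * s)) * dilate a s K x)"
      using integrable_mult_exp[OF f] by simp
    with elim have "(\<integral>y. f y * B x y \<partial>lborel) = (\<integral>y. f y * dilate a s K (x - y) \<partial>lborel)
        - (\<integral>y. f y * exp (\<i> * complex_of_real (y * s)) * dilate a s K x \<partial>lborel)"
      by (simp add: B_def right_diff_distrib mult.assoc)
    then show ?case by (simp add: conv_def fourier_lborel)
  qed
  then have "L1_norm (\<lambda>x. conv f (dilate a s K) x - fourier f s * dilate a s K x)
      = L1_norm (\<lambda>x. \<integral>y. f y * B x y \<partial>lborel)"
    using integrable_conv[OF f D] D integrable_integral_kernel[OF f B Bi BC]
    by (intro L1_norm_cong_AE borel_if_integrable) auto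
  also have "\<dots> \<le> spread_error f K a"
    using L1_norm_integral_kernel_le[OF f B Bi BC] by (simp add: BN spread_error_def)
  finally show ?thesis .
qed

subsection \<open>The Fejer kernel\<close>

text \<open>At \<open>x = 0\<close> the value is 0 by division by zero, not the limit
  \<open>a\<^sup>2 / 2\<close>; a single point does not affect the integrals.\<close>

definition cos_kernel :: "real \<Rightarrow> real \<Rightarrow> real" where
  "cos_kernel a x = (1 - cos (a * x)) / x\<^sup>2"

text \<open>The hat function \<open>max 0 (1 - \<bar>z\<bar>)\<close>, written as half a second
  difference of the absolute value: in this shape it arises from \<open>integral_cos_kernel\<close>,
  and its integer shifts telescope.\<close>

definition triangle :: "real \<Rightarrow> real" where
  "triangle z = (\<bar>z + 1\<bar> + \<bar>z - 1\<bar>) / 2 - \<bar>z\<bar>"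

lemma cos_kernel_measurable [measurable]: "cos_kernel a \<in> borel_measurable borel"
  unfolding cos_kernel_def by measurable

lemma cos_kernel_nonneg: "0 \<le> cos_kernel a x"
  by (simp add: cos_kernel_def)

lemma integrable_inverse_Suc_square: "integrable lborel (\<lambda>x::real. inverse (1 + x\<^sup>2))"
  using integrable_inverse_1_plus_square by (simp add: set_integrable_def)

lemma integrable_cos_kernel_1: "integrable lborel (cos_kernel 1)"
proof (rule Bochner_Integration.integrable_bound)
  \<comment> \<open>5/2 = 1/2 + 2, from the two bounds \<open>x\<^sup>2 / 2\<close> and 2 on
    \<open>1 - cos x\<close>.\<close>
  show "integrable lborel (\<lambda>x::real. 5/2 * inverse (1 + x\<^sup>2))"
    using integrable_inverse_Suc_square by simp
  have "cos_kernel 1 x \<le> 5/2 * inverse (1 + x\<^sup>2)" for x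
  proof (cases "x = 0")
    case False
    have "1 - cos x \<le> x\<^sup>2 / 2"
    proof -
      have "(sin (x / 2))\<^sup>2 \<le> (x / 2)\<^sup>2"
        using abs_sin_x_le_abs_x[of "x / 2"] by (simp only: abs_le_square_iff)
      moreover have "cos x = 1 - 2 * (sin (x / 2))\<^sup>2"
        using cos_double_sin[of "x / 2"] by simp
      ultimately show ?thesis by (simp add: power2_eq_square)
    qed
    moreover have "(1 - cos x) * x\<^sup>2 \<le> 2 * x\<^sup>2"
      using cos_ge_minus_one[of x] by (intro mult_right_mono) auto
    ultimately have "(1 - cos x) * (1 + x\<^sup>2) \<le> 5/2 * x\<^sup>2"
      by (simp add: algebra_simps)
    then show ?thesis
      using False by (simp add: cos_kernel_def divide_simps add_pos_nonneg) (simp add: algebra_simps)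
  qed (simp add: cos_kernel_def)
  then show "AE x in lborel. norm (cos_kernel 1 x) \<le> norm (5/2 * inverse (1 + x\<^sup>2))"
    using cos_kernel_nonneg by (auto intro!: AE_I2 order_trans[OF _ abs_ge_self])
qed simp

lemma cos_kernel_scale: "a \<noteq> 0 \<Longrightarrow> cos_kernel a x = a\<^sup>2 * cos_kernel 1 (0 + a * x)"
  by (simp add: cos_kernel_def power_mult_distrib)

lemma integrable_cos_kernel: "integrable lborel (cos_kernel a)"
proof (cases "a = 0")
  case False
  then show ?thesis
    using lborel_integrable_real_affine[OF integrable_cos_kernel_1 False, of 0]
    by (simp add: cos_kernel_scale[OF False, abs_def])
qed (simp add: cos_kernel_def[abs_def])

definition cos_mass :: real where
  "cos_mass = (\<integral>x. cos_kernel 1 x \<partial>lborel)"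

text \<open>Scaling contributes \<open>a\<^sup>2\<close> and the substitution divides by
  \<open>\<bar>a\<bar>\<close>. The absolute value that remains is what produces
  \<open>triangle\<close>.\<close>

lemma integral_cos_kernel: "(\<integral>x. cos_kernel a x \<partial>lborel) = \<bar>a\<bar> * cos_mass"
proof (cases "a = 0")
  case False
  have "cos_mass = \<bar>a\<bar> * (\<integral>x. cos_kernel 1 (0 + a * x) \<partial>lborel)"
    unfolding cos_mass_def using lborel_integral_real_affine[OF False, of "cos_kernel 1" 0] by simp
  then have "\<bar>a\<bar> * cos_mass = (\<bar>a\<bar> * \<bar>a\<bar>) * (\<integral>x. cos_kernel 1 (0 + a * x) \<partial>lborel)"
    by (simp only: mult.assoc)
  then show ?thesis by (simp add: cos_kernel_scale[OF False] power2_eq_square)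
qed (simp add: cos_kernel_def)

lemma cos_mass_pos: "0 < cos_mass"
proof -
  \<comment> \<open>A lower bound for the kernel on \<open>{1..2}\<close>: cosine decreases there,
    since \<open>pi > 3\<close>, and \<open>x\<^sup>2 \<le> 4\<close>.\<close>
  have "(1 - cos 1) / 4 = (1 - cos 1) / 4 * measure lborel {1..2::real}"
    by simp
  also have "\<dots> = (\<integral>x. (1 - cos 1) / 4 * indicator {1..2::real} x \<partial>lborel)"
    by (simp del: measure_lborel_Icc)
  also have "\<dots> \<le> cos_mass"
    unfolding cos_mass_def
  proof (rule integral_mono[OF _ integrable_cos_kernel])
    fix x :: real
    show "(1 - cos 1) / 4 * indicator {1..2::real} x \<le> cos_kernel 1 x"
    proof (cases "x \<in> {1..2}")
      case True
      then have "cos x \<le> cos 1" using pi_gt3 by (intro cos_monotone_0_pi_le) auto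
      moreover have "x\<^sup>2 \<le> 2\<^sup>2" using True by (intro power_mono) auto
      ultimately have "(1 - cos 1) / 4 \<le> (1 - cos x) / x\<^sup>2"
        using True by (intro frac_le) auto
      then show ?thesis using True by (simp add: cos_kernel_def)
    qed (simp add: cos_kernel_nonneg)
  qed simp
  finally show ?thesis
    using cos_monotone_0_pi[of 0 1] pi_gt3 by simp
qed

text \<open>Classically \<open>cos_mass\<close> is pi; the division normalises the total mass to
  1.\<close>

definition fejer :: "real \<Rightarrow> complex" where
  "fejer x = complex_of_real (cos_kernel 1 x / cos_mass)"

lemma integrable_fejer: "integrable lborel fejer"
  unfolding fejer_def[abs_def] using integrable_cos_kernel[of 1]
  by (intro integrable_of_real integrable_divide) auto

text \<open>The product formula for cosines expresses \<open>(1 - cos x) * cos (z * x)\<close> as a combination of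
  \<open>1 - cos (a * x)\<close> for \<open>a = z + 1, z - 1, z\<close>, whence no exact value of the total mass is needed.\<close>
lemma fourier_fejer: "fourier fejer z = triangle z"
proof -
  have c: "cos_kernel 1 x * cos (x * z) = cos_kernel (z + 1) x / 2 + cos_kernel (z - 1) x / 2 - cos_kernel z x" for x
  proof -
    have "(1 - cos x) * cos (x * z) = (1 - cos ((z + 1) * x)) / 2 + (1 - cos ((z - 1) * x)) / 2 - (1 - cos (z * x))"
      by (simp add: distrib_right left_diff_distrib cos_add cos_diff mult.commute) (simp add: field_simps cos_add cos_diff)
    then show ?thesis
      unfolding cos_kernel_def times_divide_eq_left mult_1_left
      by (simp only:) (simp add: add_divide_distrib diff_divide_distrib)
  qed
  have ci: "integrable lborel (\<lambda>x. cos_kernel 1 x * cos (x * z))"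
    unfolding c using integrable_cos_kernel by auto
  have cI: "(\<integral>x. cos_kernel 1 x * cos (x * z) \<partial>lborel) = cos_mass * triangle z"
    unfolding c using integrable_cos_kernel
    by (simp add: integral_cos_kernel triangle_def algebra_simps)
  have si: "integrable lborel (\<lambda>x. cos_kernel 1 x * sin (x * z))"
    by (rule Bochner_Integration.integrable_bound[OF integrable_cos_kernel[of 1]])
       (auto simp: abs_mult intro!: mult_left_le)
  have "(\<integral>x. cos_kernel 1 x * sin (x * z) \<partial>lborel) = - (\<integral>x. cos_kernel 1 x * sin (x * z) \<partial>lborel)"
    using lborel_integral_real_affine[of "-1" "\<lambda>x. cos_kernel 1 x * sin (x * z)" 0]
    by (simp add: cos_kernel_def)
  then have sI: "(\<integral>x. cos_kernel 1 x * sin (x * z) \<partial>lborel) = 0" by simp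
  have e: "exp (\<i> * complex_of_real t) = complex_of_real (cos t) + \<i> * complex_of_real (sin t)" for t
    unfolding cis_conv_exp[symmetric] by (simp add: complex_eq_iff)
  let ?p = "\<lambda>x. complex_of_real (cos_kernel 1 x * cos (x * z) / cos_mass)"
  let ?q = "\<lambda>x. complex_of_real (cos_kernel 1 x * sin (x * z) / cos_mass)"
  have p_int: "integrable lborel ?p" and q_int: "integrable lborel ?q"
    by (intro integrable_of_real integrable_divide ci si)+
  have "fejer x * exp (\<i> * complex_of_real (x * z)) = ?p x + \<i> * ?q x" for x
    unfolding e fejer_def by (simp add: distrib_left add_divide_distrib mult.left_commute)
  then have "fourier fejer z = (\<integral>x. ?p x + \<i> * ?q x \<partial>lborel)"
    unfolding fourier_lborel[OF borel_if_integrable[OF integrable_fejer]] by (simp only:)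
  also have "\<dots> = (\<integral>x. ?p x \<partial>lborel) + \<i> * (\<integral>x. ?q x \<partial>lborel)"
    unfolding Bochner_Integration.integral_add[OF p_int integrable_mult_right[OF q_int]] integral_mult_right_zero ..
  also have "\<dots> = triangle z"
    unfolding integral_complex_of_real integral_divide_zero
    using cos_mass_pos by (simp add: cI sI)
  finally show ?thesis .
qed

section \<open>The triangle as a convolution kernel of nonzero mass\<close>

lemma triangle_measurable [measurable]: "triangle \<in> borel_measurable borel"
  unfolding triangle_def by measurable

lemma integrable_triangle: "integrable lborel triangle"
proof (rule Bochner_Integration.integrable_bound)
  show "integrable lborel (indicator {-1..1} :: real \<Rightarrow> real)"
    by (intro integrable_real_indicator) auto
  have "\<bar>triangle z\<bar> \<le> indicator {-1..1} z" for z
    by (auto simp: triangle_def indicator_def abs_if)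
  then show "AE z in lborel. norm (triangle z) \<le> norm (indicator {-1..1} z :: real)"
    by simp
qed simp

lemma integral_triangle: "(\<integral>z. triangle z \<partial>lborel) > 0"
proof -
  have "1/2 = (1/2) * measure lborel {-1/2..1/2::real}" by simp
  also have "\<dots> = (\<integral>z. 1/2 * indicator {-1/2..1/2::real} z \<partial>lborel)"
    by (simp del: measure_lborel_Icc)
  also have "\<dots> \<le> (\<integral>z. triangle z \<partial>lborel)"
  proof (rule integral_mono[OF _ integrable_triangle])
    show "1/2 * indicator {-1/2..1/2::real} z \<le> triangle z" for z
      by (auto simp: triangle_def indicator_def abs_if)
  qed simp
  finally show ?thesis by simp
qed

subsection \<open>Injectivity of the Fourier transform\<close>

text \<open>Fourier inversion for the dilated kernel, whose Fourier representation is known because it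
  is itself the Fourier transform of \<open>fejer\<close>.\<close>
lemma conv_dilate_triangle_eq_0:
  assumes u: "integrable lborel u" and z: "\<And>\<zeta>. fourier u \<zeta> = 0" and a: "0 < a"
  shows "conv (dilate a 0 (\<lambda>z. complex_of_real (triangle z))) u x = 0"
proof -
  let ?B = "\<lambda>z \<zeta>. exp (\<i> * complex_of_real (\<zeta> * z)) * u (x - z / a)"
  note [measurable] = borel_if_integrable[OF u] borel_if_integrable[OF integrable_fejer]
  have ui: "integrable lborel (\<lambda>z. u (x - z / a))"
    using lborel_integrable_real_affine[OF u, of "-1/a" x] a by simp
  have B: "case_prod ?B \<in> borel_measurable (borel \<Otimes>\<^sub>M borel)" by measurable
  have Bi: "integrable lborel (\<lambda>z. ?B z \<zeta>)" for \<zeta>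
    by (rule Bochner_Integration.integrable_bound[OF ui]) (auto simp: norm_mult)
  have BC: "L1_norm (\<lambda>z. ?B z \<zeta>) \<le> L1_norm (\<lambda>z. u (x - z / a))" for \<zeta>
    by (simp add: L1_norm_def norm_mult)
  \<comment> \<open>Substituting \<open>x - z / a\<close> turns this integral into a multiple of
    \<open>fourier u (- a * \<zeta>)\<close>.\<close>
  have B0: "(\<integral>z. ?B z \<zeta> \<partial>lborel) = 0" for \<zeta>
  proof -
    have "exp (\<i> * complex_of_real ((x + - 1 / a * z) * (- a * \<zeta>)))
      = exp (- (\<i> * complex_of_real (x * a * \<zeta>))) * exp (\<i> * complex_of_real (\<zeta> * z))" for z
    proof -
      have "(x + - 1 / a * z) * (- a * \<zeta>) = - (x * a * \<zeta>) + \<zeta> * z"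
        using a by (simp add: field_simps)
      then show ?thesis
        unfolding exp_add[symmetric] by (simp only:) (simp add: algebra_simps)
    qed
    then have "0 = inverse a *\<^sub>R (\<integral>z. exp (- (\<i> * complex_of_real (x * a * \<zeta>))) * ?B z \<zeta> \<partial>lborel)"
      using z[of "- a * \<zeta>"] a
        lborel_integral_real_affine[of "-1/a" "\<lambda>z. u z * exp (\<i> * complex_of_real (z * (- a * \<zeta>)))" x]
      by (simp add: fourier_lborel mult_ac divide_inverse)
    then show ?thesis using a by simp
  qed
  have "conv (dilate a 0 (\<lambda>z. complex_of_real (triangle z))) u x
    = (\<integral>z. complex_of_real (triangle z) * u (x - z / a) \<partial>lborel)"
    using a by (intro conv_dilate_0) auto
  also have "\<dots> = (\<integral>z. \<integral>\<zeta>. fejer \<zeta> * ?B z \<zeta> \<partial>lborel \<partial>lborel)"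
    by (simp add: fourier_fejer[symmetric] fourier_lborel mult.assoc flip: integral_mult_left_zero)
  also have "\<dots> = (\<integral>\<zeta>. \<integral>z. fejer \<zeta> * ?B z \<zeta> \<partial>lborel \<partial>lborel)"
    by (rule lborel_pair.Fubini_integral[OF integrable_kernel[OF integrable_fejer B Bi BC]])
  also have "\<dots> = 0" by (simp only: integral_mult_right_zero B0) simp
  finally show ?thesis .
qed

lemma L1_norm_eq_0D:
  assumes u: "integrable lborel u" and "L1_norm u = 0"
  shows "AE x in lborel. u x = 0"
  using assms integral_nonneg_eq_0_iff_AE[of lborel "\<lambda>x. norm (u x)"]
  by (simp add: L1_norm_lborel borel_if_integrable)

text \<open>The convolutions of \<open>u\<close> with dilated triangles all vanish, yet converge in
  L1 to \<open>c * u\<close>, where \<open>c\<close> is the positive integral of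
  \<open>triangle\<close>.\<close>

lemma fourier_eq_0D:
  assumes u: "integrable lborel u" and z: "\<And>\<zeta>. fourier u \<zeta> = 0"
  shows "AE x in lborel. u x = 0"
proof (rule L1_norm_eq_0D[OF u])
  define c where "c = fourier (\<lambda>z. complex_of_real (triangle z)) 0"
  have "c \<noteq> 0"
    using integral_triangle by (simp add: c_def fourier_lborel)
  have "(\<lambda>n::nat. L1_norm (\<lambda>x. 0 - c * u x)) \<longlonglongrightarrow> 0"
    using approximate_identity[OF integrable_of_real[OF integrable_triangle] u]
    by (simp only: conv_dilate_triangle_eq_0[OF u z] of_nat_0_less_iff zero_less_Suc c_def)
  then have "L1_norm (\<lambda>x. 0 - c * u x) = 0" by (simp add: LIMSEQ_const_iff)
  moreover have "L1_norm (\<lambda>x. 0 - c * u x) = norm c * L1_norm u"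
    by (simp add: L1_norm_def norm_mult)
  ultimately show "L1_norm u = 0" using \<open>c \<noteq> 0\<close> by simp
qed

lemma fourier_inject:
  assumes "integrable lborel u" "integrable lborel v"
    and "\<And>\<zeta>. fourier u \<zeta> = fourier v \<zeta>"
  shows "AE x in lborel. u x = v x"
  using fourier_eq_0D[of "\<lambda>x. u x - v x"] assms by (simp add: fourier_diff)

text \<open>\<open>is_hilbert_transform\<close> says nothing at frequency 0; continuity of the
  transforms supplies that value.\<close>

lemma fourier_inject_nonzero:
  assumes u: "integrable lborel u" and v: "integrable lborel v"
    and eq: "\<And>\<zeta>. \<zeta> \<noteq> 0 \<Longrightarrow> fourier u \<zeta> = fourier v \<zeta>"
  shows "AE x in lborel. u x = v x"
proof (rule fourier_inject[OF u v])
  fix \<zeta>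
  have "isCont (fourier u) 0" "isCont (fourier v) 0"
    using continuous_fourier[OF u] continuous_fourier[OF v]
    by (auto simp: continuous_on_eq_continuous_at)
  then have "fourier u \<midarrow>0\<rightarrow> fourier u 0" "fourier v \<midarrow>0\<rightarrow> fourier v 0"
    by (auto simp: isCont_def)
  moreover have "fourier u \<midarrow>0\<rightarrow> l \<longleftrightarrow> fourier v \<midarrow>0\<rightarrow> l" for l
    using eq by (intro LIM_cong) auto
  ultimately have "fourier u 0 = fourier v 0" using LIM_unique by blast
  with eq show "fourier u \<zeta> = fourier v \<zeta>" by (cases "\<zeta> = 0") auto
qed

subsection \<open>The closed span of the translates\<close>

text \<open>An element of the Hardy space is represented by a pair of a function and its Hilbert
  transform, so that its norm is the sum of two \<open>L\<^sup>1\<close> norms.\<close>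
inductive translate_span ::
  "(real \<Rightarrow> complex) \<Rightarrow> (real \<Rightarrow> complex) \<Rightarrow> (real \<Rightarrow> complex) \<Rightarrow> (real \<Rightarrow> complex) \<Rightarrow> bool"
  for f f' where
  zero: "translate_span f f' (\<lambda>_. 0) (\<lambda>_. 0)"
| step: "translate_span f f' u v \<Longrightarrow>
    translate_span f f' (\<lambda>x. u x + c * f (x - t)) (\<lambda>x. v x + c * f' (x - t))"

text \<open>A single \<open>translate_span\<close> pair, hence one choice of coefficients and
  shifts, has to approximate both components at once; this is closeness in the Hardy norm.\<close>

definition translate_closure ::
  "(real \<Rightarrow> complex) \<Rightarrow> (real \<Rightarrow> complex) \<Rightarrow> (real \<Rightarrow> complex) \<Rightarrow> (real \<Rightarrow> complex) \<Rightarrow> bool" where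
  "translate_closure f f' u v \<longleftrightarrow> (\<forall>e>0. \<exists>p q. translate_span f f' p q \<and>
     L1_norm (\<lambda>x. u x - p x) + L1_norm (\<lambda>x. v x - q x) < e)"

lemma translate_span_add:
  assumes "translate_span f f' p q" "translate_span f f' u v"
  shows "translate_span f f' (\<lambda>x. u x + p x) (\<lambda>x. v x + q x)"
  using assms
proof (induction rule: translate_span.induct)
  case zero
  then show ?case by simp
next
  case (step p q c t)
  from translate_span.step[OF step.IH[OF step.prems], of c t]
  show ?case by (simp add: add.assoc)
qed

lemma translate_span_cmult:
  assumes "translate_span f f' p q"
  shows "translate_span f f' (\<lambda>x. d * p x) (\<lambda>x. d * q x)"
  using assms
proof (induction rule: translate_span.induct)
  case zero
  then show ?case by (simp add: translate_span.zero)
next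
  case (step p q c t)
  from translate_span.step[OF step.IH, of "d * c" t]
  show ?case by (simp add: distrib_left mult.assoc)
qed

lemma translate_span_sum:
  assumes "finite K"
  shows "translate_span f f' (\<lambda>x. \<Sum>k\<in>K. c k * f (x - t k)) (\<lambda>x. \<Sum>k\<in>K. c k * f' (x - t k))"
  using assms
proof induction
  case empty
  then show ?case by (simp add: translate_span.zero)
next
  case (insert k K)
  from translate_span.step[OF insert.IH, of "c k" "t k"] insert.hyps
  show ?case by (simp add: add.commute)
qed

text \<open>Riemann sums for \<open>\<phi> * f\<close>: the translation parameter is rounded down to a grid of mesh
  \<open>1/(n+1)\<close> and cut off to a window of size growing with \<open>n\<close>, so that finitely many translates occur.\<close>
definition step_kernel :: "nat \<Rightarrow> (real \<Rightarrow> complex) \<Rightarrow> real \<Rightarrow> real \<Rightarrow> complex" where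
  "step_kernel n f x y =
     (\<Sum>k\<in>{- int (Suc n * Suc n)..int (Suc n * Suc n)}.
        of_bool (\<lfloor>real (Suc n) * y\<rfloor> = k) * f (x - real_of_int k / real (Suc n)))"

text \<open>The integral of \<open>\<phi>\<close> over one grid cell. With these weights the Riemann
  sum is exactly the integral of \<open>\<phi>\<close> against \<open>step_kernel\<close>.\<close>

definition step_coeff :: "nat \<Rightarrow> (real \<Rightarrow> complex) \<Rightarrow> int \<Rightarrow> complex" where
  "step_coeff n \<phi> k = (\<integral>y. \<phi> y * of_bool (\<lfloor>real (Suc n) * y\<rfloor> = k) \<partial>lborel)"

lemma step_kernel_eq:
  "step_kernel n f x y =
     of_bool (\<lfloor>real (Suc n) * y\<rfloor> \<in> {- int (Suc n * Suc n)..int (Suc n * Suc n)}) *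
       f (x - real_of_int \<lfloor>real (Suc n) * y\<rfloor> / real (Suc n))"
  unfolding step_kernel_def
  by (subst sum.cong[OF refl, where h = "\<lambda>k. if k = \<lfloor>real (Suc n) * y\<rfloor> then f (x - real_of_int k / real (Suc n)) else 0"])
     (auto simp del: of_nat_Suc)

text \<open>For fixed \<open>y\<close> the window eventually contains \<open>y\<close>, and then
  only the rounding error, below the mesh, is left for continuity of translation. The kernels stay
  bounded by twice the norm of \<open>f\<close>, so the decay passes through the integral.\<close>

lemma tendsto_conv_step:
  assumes \<phi>: "integrable lborel \<phi>" and f: "integrable lborel f"
  shows "(\<lambda>n. L1_norm (\<lambda>x. conv \<phi> f x -
     (\<Sum>k\<in>{- int (Suc n * Suc n)..int (Suc n * Suc n)}. step_coeff n \<phi> k * f (x - real_of_int k / real (Suc n)))))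
     \<longlonglongrightarrow> 0"
proof -
  note [measurable] = borel_if_integrable[OF \<phi>] borel_if_integrable[OF f]
  define B where "B n x y = f (x - y) - step_kernel n f x y" for n x y
  have B: "case_prod (B n) \<in> borel_measurable (borel \<Otimes>\<^sub>M borel)" for n
    unfolding B_def step_kernel_def by measurable
  have sti: "integrable lborel (\<lambda>x. step_kernel n f x y)" for n y
    unfolding step_kernel_eq using integrable_translate[OF f] by auto
  have Bi: "integrable lborel (\<lambda>x. B n x y)" for n y
    unfolding B_def using integrable_translate[OF f] sti by auto
  have stN: "L1_norm (\<lambda>x. step_kernel n f x y) \<le> L1_norm f" for n y
    unfolding step_kernel_eq L1_norm_cmult L1_norm_translate[OF f]
    by (intro mult_left_le_one_le) auto
  have BC: "L1_norm (\<lambda>x. B n x y) \<le> L1_norm f + L1_norm f" for n y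
    unfolding B_def
    using add_left_mono[OF stN[of n y], of "L1_norm f"]
      L1_norm_diff_le[OF integrable_translate[OF f, of y] sti, unfolded L1_norm_translate[OF f]]
    by (rule order_trans[rotated])
  have lim0: "(\<lambda>n. L1_norm (\<lambda>x. B n x y)) \<longlonglongrightarrow> 0" for y
  proof -
    define s where "s n = y - real_of_int \<lfloor>real (Suc n) * y\<rfloor> / real (Suc n)" for n
    have s0: "s n = frac (real (Suc n) * y) * inverse (real (Suc n))" for n
      by (simp add: s_def frac_def field_simps)
    have "(\<lambda>n. s n) \<longlonglongrightarrow> 0"
    proof (rule tendsto_sandwich[OF always_eventually always_eventually tendsto_const LIMSEQ_inverse_real_of_nat])
      show "\<forall>n. 0 \<le> s n" unfolding s0 by (auto intro!: mult_nonneg_nonneg)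
      show "\<forall>n. s n \<le> inverse (real (Suc n))"
        unfolding s0 using frac_lt_1 by (auto intro!: mult_left_le_one_le less_imp_le)
    qed
    then have l: "(\<lambda>n. L1_norm (\<lambda>x. f (x - s n) - f x)) \<longlonglongrightarrow> 0"
      by (rule tendsto_L1_translate[OF f])
    have "\<forall>\<^sub>F n in sequentially. L1_norm (\<lambda>x. f (x - s n) - f x) = L1_norm (\<lambda>x. B n x y)"
    proof (rule eventually_sequentiallyI)
      \<comment> \<open>The \<open>+ 1\<close> leaves room for the floor, which can exceed a
        negative number in absolute value by almost 1.\<close>
      fix n assume n: "nat \<lceil>\<bar>y\<bar> + 1\<rceil> \<le> n"
      then have "\<bar>y\<bar> + 1 \<le> real (Suc n)" by linarith
      then have "real (Suc n) * (\<bar>y\<bar> + 1) \<le> real (Suc n) * real (Suc n)"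
        by (intro mult_left_mono) auto
      then have m: "real (Suc n) * \<bar>y\<bar> + real (Suc n) \<le> real (Suc n) * real (Suc n)"
        by (simp only: distrib_left mult_1_right)
      have r: "real_of_int (int (Suc n * Suc n)) = real (Suc n) * real (Suc n)"
        by (simp only: of_int_of_nat_eq of_nat_mult of_int_mult)
      have ab: "\<bar>real (Suc n) * y\<bar> = real (Suc n) * \<bar>y\<bar>" by (simp add: abs_mult)
      have "\<lfloor>real (Suc n) * y\<rfloor> \<in> {- int (Suc n * Suc n)..int (Suc n * Suc n)}"
        using m r ab of_nat_Suc[of n, where 'a = real] of_nat_0_le_iff[of n, where 'a = real]
        by (simp only: atLeastAtMost_iff le_floor_iff floor_le_iff of_int_minus) (smt (verit))
      then have "B n x y = f (x - y) - f (x - real_of_int \<lfloor>real (Suc n) * y\<rfloor> / real (Suc n))" for x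
        by (simp only: B_def step_kernel_eq) simp
      moreover have "L1_norm (\<lambda>x. f (x - y) - f (x - real_of_int \<lfloor>real (Suc n) * y\<rfloor> / real (Suc n)))
         = L1_norm (\<lambda>x. f (x - s n) - f x)"
        using L1_norm_translate[of "\<lambda>x. f (x - s n) - f x" "real_of_int \<lfloor>real (Suc n) * y\<rfloor> / real (Suc n)"]
          f integrable_translate[OF f]
        by (simp add: s_def)
      ultimately show "L1_norm (\<lambda>x. f (x - s n) - f x) = L1_norm (\<lambda>x. B n x y)" by simp
    qed
    from tendsto_cong[OF this] l show ?thesis by simp
  qed
  have lim: "(\<lambda>n. \<integral>y. norm (\<phi> y) * L1_norm (\<lambda>x. B n x y) \<partial>lborel) \<longlonglongrightarrow> 0"
    by (intro tendsto_integral_L1_norm_kernel[OF \<phi> B Bi BC lim0])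
  show ?thesis
  proof (rule tendsto_L1_norm_0[OF lim])
    fix n
    let ?K = "{- int (Suc n * Suc n)..int (Suc n * Suc n)}"
    let ?S = "\<lambda>x. \<Sum>k\<in>?K. step_coeff n \<phi> k * f (x - real_of_int k / real (Suc n))"
    have \<phi>b: "integrable lborel (\<lambda>y. \<phi> y * of_bool (\<lfloor>real (Suc n) * y\<rfloor> = k))" for k
      by (rule Bochner_Integration.integrable_bound[OF \<phi>]) (auto simp: norm_mult)
    have Si: "integrable lborel ?S"
      using integrable_translate[OF f] by (intro Bochner_Integration.integrable_sum integrable_mult_right)
    have "AE x in lborel. conv \<phi> f x - ?S x = (\<integral>y. \<phi> y * B n x y \<partial>lborel)"
      using AE_integrable_conv[OF \<phi> f]
    proof eventually_elim
      case (elim x)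
      have t: "integrable lborel (\<lambda>y. \<phi> y * of_bool (\<lfloor>real (Suc n) * y\<rfloor> = k) * f (x - real_of_int k / real (Suc n)))" for k
        using \<phi>b[of k] by (rule integrable_mult_left)
      have "(\<integral>y. \<phi> y * B n x y \<partial>lborel) = (\<integral>y. \<phi> y * f (x - y) -
          (\<Sum>k\<in>?K. \<phi> y * of_bool (\<lfloor>real (Suc n) * y\<rfloor> = k) * f (x - real_of_int k / real (Suc n))) \<partial>lborel)"
        by (simp only: B_def step_kernel_def right_diff_distrib sum_distrib_left mult.assoc)
      also have "\<dots> = conv \<phi> f x - ?S x"
        unfolding Bochner_Integration.integral_diff[OF elim Bochner_Integration.integrable_sum[OF t]]
          Bochner_Integration.integral_sum[OF t] integral_mult_left_zero conv_def step_coeff_def ..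
      finally show ?case ..
    qed
    then have "L1_norm (\<lambda>x. conv \<phi> f x - ?S x) = L1_norm (\<lambda>x. \<integral>y. \<phi> y * B n x y \<partial>lborel)"
      using integrable_conv[OF \<phi> f] Si integrable_integral_kernel[OF \<phi> B Bi BC]
      by (intro L1_norm_cong_AE borel_if_integrable Bochner_Integration.integrable_diff)
    then show "L1_norm (\<lambda>x. conv \<phi> f x - ?S x) \<le> (\<integral>y. norm (\<phi> y) * L1_norm (\<lambda>x. B n x y) \<partial>lborel)"
      using L1_norm_integral_kernel_le[OF \<phi> B Bi BC] by simp
  qed
qed

context
  fixes f f' :: "real \<Rightarrow> complex"
  assumes f: "integrable lborel f" and f': "integrable lborel f'"
begin

lemma integrable_translate_span:
  assumes "translate_span f f' p q"
  shows "integrable lborel p \<and> integrable lborel q"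
  using assms
  by induction (auto simp: integrable_translate f f')

lemma translate_closure_zero: "translate_closure f f' (\<lambda>_. 0) (\<lambda>_. 0)"
  unfolding translate_closure_def using translate_span.zero[of f f']
  by (auto simp: L1_norm_def intro!: exI[of _ "\<lambda>_. 0"])

text \<open>The closure is closed. The iteration in the local inversion and the two frequency
  cut-offs enter through this lemma.\<close>

lemma translate_closure_limit:
  assumes u: "integrable lborel u" and v: "integrable lborel v"
    and lim: "\<And>e. 0 < e \<Longrightarrow> \<exists>k l. integrable lborel k \<and> integrable lborel l \<and> translate_closure f f' k l \<and>
       L1_norm (\<lambda>x. u x - k x) + L1_norm (\<lambda>x. v x - l x) < e"
  shows "translate_closure f f' u v"
  unfolding translate_closure_def
proof (intro allI impI)
  fix e :: real assume "0 < e"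
  then obtain k l where kl: "integrable lborel k" "integrable lborel l" "translate_closure f f' k l"
    and 1: "L1_norm (\<lambda>x. u x - k x) + L1_norm (\<lambda>x. v x - l x) < e / 2"
    using lim[of "e / 2"] by auto
  then obtain p q where pq: "translate_span f f' p q"
    and 2: "L1_norm (\<lambda>x. k x - p x) + L1_norm (\<lambda>x. l x - q x) < e / 2"
    unfolding translate_closure_def using \<open>0 < e\<close> by (meson half_gt_zero)
  have "L1_norm (\<lambda>x. u x - p x) \<le> L1_norm (\<lambda>x. u x - k x) + L1_norm (\<lambda>x. k x - p x)"
    "L1_norm (\<lambda>x. v x - q x) \<le> L1_norm (\<lambda>x. v x - l x) + L1_norm (\<lambda>x. l x - q x)"
    using integrable_translate_span[OF pq] u v kl by (auto intro!: L1_norm_diff_triangle)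
  with 1 2 have "L1_norm (\<lambda>x. u x - p x) + L1_norm (\<lambda>x. v x - q x) < e" by linarith
  with pq show "\<exists>p q. translate_span f f' p q \<and> L1_norm (\<lambda>x. u x - p x) + L1_norm (\<lambda>x. v x - q x) < e"
    by blast
qed

text \<open>Injectivity of the Fourier transform yields identities only almost everywhere; this
  makes them usable for functions.\<close>

lemma translate_closure_cong_AE:
  assumes "translate_closure f f' k l"
    and int: "integrable lborel u" "integrable lborel v" "integrable lborel k" "integrable lborel l"
    and ae: "AE x in lborel. u x = k x" "AE x in lborel. v x = l x"
  shows "translate_closure f f' u v"
proof (rule translate_closure_limit[OF int(1,2)])
  have "L1_norm (\<lambda>x. u x - k x) = L1_norm (\<lambda>x. 0)" "L1_norm (\<lambda>x. v x - l x) = L1_norm (\<lambda>x. 0)"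
    using int ae by (auto intro!: L1_norm_cong_AE borel_if_integrable)
  then show "\<exists>k l. integrable lborel k \<and> integrable lborel l \<and> translate_closure f f' k l \<and>
       L1_norm (\<lambda>x. u x - k x) + L1_norm (\<lambda>x. v x - l x) < e" if "0 < e" for e
    using assms(1) int that by (intro exI[of _ k] exI[of _ l]) (simp add: L1_norm_def)
qed

lemma translate_closure_add:
  assumes "translate_closure f f' u v" "translate_closure f f' k l"
    and int: "integrable lborel u" "integrable lborel v" "integrable lborel k" "integrable lborel l"
  shows "translate_closure f f' (\<lambda>x. u x + k x) (\<lambda>x. v x + l x)"
  unfolding translate_closure_def
proof (intro allI impI)
  fix e :: real assume e: "0 < e"
  obtain p q where pq: "translate_span f f' p q"
    and 1: "L1_norm (\<lambda>x. u x - p x) + L1_norm (\<lambda>x. v x - q x) < e / 2"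
    using assms(1) e unfolding translate_closure_def by (meson half_gt_zero)
  obtain p' q' where pq': "translate_span f f' p' q'"
    and 2: "L1_norm (\<lambda>x. k x - p' x) + L1_norm (\<lambda>x. l x - q' x) < e / 2"
    using assms(2) e unfolding translate_closure_def by (meson half_gt_zero)
  have "L1_norm (\<lambda>x. (u x - p x) + (k x - p' x)) \<le> L1_norm (\<lambda>x. u x - p x) + L1_norm (\<lambda>x. k x - p' x)"
    "L1_norm (\<lambda>x. (v x - q x) + (l x - q' x)) \<le> L1_norm (\<lambda>x. v x - q x) + L1_norm (\<lambda>x. l x - q' x)"
    using integrable_translate_span[OF pq] integrable_translate_span[OF pq'] int
    by (auto intro!: L1_norm_add_le)
  then have "L1_norm (\<lambda>x. u x + k x - (p x + p' x)) + L1_norm (\<lambda>x. v x + l x - (q x + q' x)) < e"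
    using 1 2 by (simp add: add_diff_add)
  with translate_span_add[OF pq' pq]
  show "\<exists>p q. translate_span f f' p q \<and>
      L1_norm (\<lambda>x. u x + k x - p x) + L1_norm (\<lambda>x. v x + l x - q x) < e"
    by blast
qed

lemma translate_closure_cmult:
  assumes "translate_closure f f' u v"
  shows "translate_closure f f' (\<lambda>x. c * u x) (\<lambda>x. c * v x)"
  unfolding translate_closure_def
proof (intro allI impI)
  fix e :: real assume "0 < e"
  then have "0 < e / (norm c + 1)" by (simp add: add_nonneg_pos)
  then obtain p q where pq: "translate_span f f' p q"
    and 1: "L1_norm (\<lambda>x. u x - p x) + L1_norm (\<lambda>x. v x - q x) < e / (norm c + 1)" (is "?s < _")
    using assms unfolding translate_closure_def by meson
  have "norm c * ?s \<le> (norm c + 1) * ?s"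
    by (intro mult_right_mono) (auto intro!: add_nonneg_nonneg)
  also have "\<dots> < e"
    using 1 by (simp add: pos_less_divide_eq add_nonneg_pos mult.commute)
  finally have "norm c * ?s < e" .
  then have "L1_norm (\<lambda>x. c * u x - c * p x) + L1_norm (\<lambda>x. c * v x - c * q x) < e"
    by (simp only: right_diff_distrib[symmetric] L1_norm_cmult distrib_left)
  with translate_span_cmult[OF pq, of c]
  show "\<exists>p q. translate_span f f' p q \<and>
      L1_norm (\<lambda>x. c * u x - p x) + L1_norm (\<lambda>x. c * v x - q x) < e"
    by blast
qed

lemma translate_closure_sum:
  assumes "\<And>i. i \<in> I \<Longrightarrow> integrable lborel (u i)" "\<And>i. i \<in> I \<Longrightarrow> integrable lborel (v i)"
    "\<And>i. i \<in> I \<Longrightarrow> translate_closure f f' (u i) (v i)"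
  shows "translate_closure f f' (\<lambda>x. \<Sum>i\<in>I. u i x) (\<lambda>x. \<Sum>i\<in>I. v i x)"
  using assms
proof (induction I rule: infinite_finite_induct)
  case (insert i I)
  then show ?case by (simp add: translate_closure_add)
qed (simp_all add: translate_closure_zero)

text \<open>Grid and coefficients depend only on \<open>\<phi>\<close> and \<open>n\<close>, so the
  same Riemann sum serves \<open>f\<close> and \<open>f'\<close> and forms a pair in
  \<open>translate_span\<close>.\<close>

lemma translate_closure_conv:
  assumes \<phi>: "integrable lborel \<phi>"
  shows "translate_closure f f' (conv \<phi> f) (conv \<phi> f')"
  unfolding translate_closure_def
proof (intro allI impI)
  fix e :: real assume e: "0 < e"
  let ?S = "\<lambda>n f x. \<Sum>k\<in>{- int (Suc n * Suc n)..int (Suc n * Suc n)}. step_coeff n \<phi> k * f (x - real_of_int k / real (Suc n))"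
  have "(\<lambda>n. L1_norm (\<lambda>x. conv \<phi> f x - ?S n f x) + L1_norm (\<lambda>x. conv \<phi> f' x - ?S n f' x)) \<longlonglongrightarrow> 0 + 0"
    by (intro tendsto_add tendsto_conv_step \<phi> f f')
  then have "\<forall>\<^sub>F n in sequentially.
      L1_norm (\<lambda>x. conv \<phi> f x - ?S n f x) + L1_norm (\<lambda>x. conv \<phi> f' x - ?S n f' x) < e"
    by (rule order_tendstoD(2)) (use e in simp)
  then obtain n where "L1_norm (\<lambda>x. conv \<phi> f x - ?S n f x) + L1_norm (\<lambda>x. conv \<phi> f' x - ?S n f' x) < e"
    by (auto dest: eventually_happens)
  then show "\<exists>p q. translate_span f f' p q \<and>
      L1_norm (\<lambda>x. conv \<phi> f x - p x) + L1_norm (\<lambda>x. conv \<phi> f' x - q x) < e"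
    by (intro exI[of _ "?S n f"] exI[of _ "?S n f'"] conjI translate_span_sum) auto
qed

end

subsection \<open>Local inversion\<close>

text \<open>Convolution with \<open>V\<close> reproduces \<open>h\<close>. In this form, rather than
  through supports, the property is visibly kept when \<open>fourier h\<close> is multiplied by any
  function.\<close>

definition band :: "(real \<Rightarrow> complex) \<Rightarrow> (real \<Rightarrow> complex) \<Rightarrow> bool" where
  "band V h \<longleftrightarrow> (\<forall>\<zeta>. fourier V \<zeta> * fourier h \<zeta> = fourier h \<zeta>)"

text \<open>Since \<open>V\<close> reproduces \<open>h\<close>, the transforms show that
  \<open>g\<close> is \<open>- inverse z\<close> times the convolution of
  \<open>conv f V - z * V\<close> with \<open>h\<close>; \<open>near\<close> and Young's inequality
  give the factor 1/2.\<close>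

lemma L1_norm_band_contraction:
  assumes f: "integrable lborel f" and V: "integrable lborel V"
    and h: "integrable lborel h" and g: "integrable lborel g"
    and b: "band V h" and z: "z \<noteq> 0"
    and near: "L1_norm (\<lambda>x. conv f V x - z * V x) \<le> norm z / 2"
    and gh: "\<And>\<zeta>. fourier g \<zeta> = (1 - fourier f \<zeta> / z) * fourier h \<zeta>"
  shows "L1_norm g \<le> L1_norm h / 2"
proof -
  let ?D = "\<lambda>x. conv f V x - z * V x"
  let ?w = "\<lambda>x. - inverse z * conv ?D h x"
  have D: "integrable lborel ?D" using integrable_conv[OF f V] V by auto
  have w: "integrable lborel ?w" using integrable_conv[OF D h] by (rule integrable_mult_right)
  have "AE x in lborel. g x = ?w x"
  proof (rule fourier_inject[OF g w])
    fix \<zeta>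
    have "fourier ?D \<zeta> = (fourier f \<zeta> - z) * fourier V \<zeta>"
      using integrable_conv[OF f V] V by (simp add: fourier_diff fourier_cmult fourier_conv f left_diff_distrib)
    then have "fourier ?w \<zeta> = - inverse z * ((fourier f \<zeta> - z) * (fourier V \<zeta> * fourier h \<zeta>))"
      using integrable_conv[OF D h] by (simp only: fourier_cmult fourier_conv[OF D h] mult.assoc)
    also have "\<dots> = - inverse z * ((fourier f \<zeta> - z) * fourier h \<zeta>)"
      using b by (simp add: band_def)
    also have "\<dots> = fourier g \<zeta>"
      using z by (simp add: gh field_simps)
    finally show "fourier g \<zeta> = fourier ?w \<zeta>" ..
  qed
  then have "L1_norm g = inverse (norm z) * L1_norm (conv ?D h)"
    using L1_norm_cong_AE[OF borel_if_integrable[OF g] borel_if_integrable[OF w]]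
    by (simp only: L1_norm_cmult norm_minus_cancel norm_inverse)
  also have "\<dots> \<le> inverse (norm z) * (L1_norm ?D * L1_norm h)"
    by (intro mult_left_mono L1_norm_conv_le D h) auto
  also have "\<dots> \<le> inverse (norm z) * ((norm z / 2) * L1_norm h)"
    by (intro mult_left_mono mult_right_mono near) auto
  also have "\<dots> = L1_norm h / 2" using z by (simp add: field_simps)
  finally show ?thesis .
qed

text \<open>Local inversion without a Neumann series: \<open>h - conv h f / z\<close> is again band-limited and at
  most half as large as \<open>h\<close>, while \<open>conv h f\<close> lies in the closure. Iterate.\<close>
lemma translate_closure_band:
  assumes f: "integrable lborel f" and f': "integrable lborel f'" and V: "integrable lborel V"
    and z: "z \<noteq> 0" and near: "L1_norm (\<lambda>x. conv f V x - z * V x) \<le> norm z / 2"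
    and h: "integrable lborel h" "integrable lborel h'" "band V h" "band V h'"
    and compat: "\<And>\<zeta>. fourier f' \<zeta> * fourier h \<zeta> = fourier f \<zeta> * fourier h' \<zeta>"
  shows "translate_closure f f' h h'"
proof -
  \<comment> \<open>\<open>h\<close> and \<open>h'\<close> are rebound: the induction replaces the
    pair by its remainder, while \<open>V\<close> and \<open>z\<close> stay fixed.\<close>
  have approx: "\<exists>k l. integrable lborel k \<and> integrable lborel l \<and> translate_closure f f' k l \<and>
      L1_norm (\<lambda>x. h x - k x) + L1_norm (\<lambda>x. h' x - l x) \<le> (1/2) ^ n * (L1_norm h + L1_norm h')"
    if "integrable lborel h" "integrable lborel h'" "band V h" "band V h'"
      "\<And>\<zeta>. fourier f' \<zeta> * fourier h \<zeta> = fourier f \<zeta> * fourier h' \<zeta>" for n h h'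
    using that
  proof (induction n arbitrary: h h')
    case 0
    show ?case
      using translate_closure_zero[OF f f'] by (intro exI[of _ "\<lambda>_. 0"]) simp
  next
    case (Suc n)
    let ?c = "\<lambda>x. inverse z * conv h f x" and ?c' = "\<lambda>x. inverse z * conv h f' x"
    let ?h = "\<lambda>x. h x - ?c x" and ?h' = "\<lambda>x. h' x - ?c' x"
    note h = Suc.prems(1) and h' = Suc.prems(2)
    have ci: "integrable lborel ?c" "integrable lborel ?c'"
      using integrable_conv[OF h f] integrable_conv[OF h f'] by auto
    have hi: "integrable lborel ?h" "integrable lborel ?h'"
      using h h' ci by auto
    have Fh: "fourier ?h \<zeta> = (1 - fourier f \<zeta> / z) * fourier h \<zeta>" for \<zeta>
      by (simp only: fourier_diff[OF h ci(1)] fourier_cmult[OF integrable_conv[OF h f]] fourier_conv[OF h f])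
         (simp add: divide_inverse algebra_simps)
    \<comment> \<open>The subtracted term is \<open>conv h f'\<close>, not a convolution of
      \<open>h'\<close>; the compatibility relation rewrites its transform as
      \<open>fourier f \<zeta> * fourier h' \<zeta>\<close>.\<close>
    have Fh': "fourier ?h' \<zeta> = (1 - fourier f \<zeta> / z) * fourier h' \<zeta>" for \<zeta>
    proof -
      have "fourier ?h' \<zeta> = fourier h' \<zeta> - inverse z * (fourier f' \<zeta> * fourier h \<zeta>)"
        by (simp only: fourier_diff[OF h' ci(2)] fourier_cmult[OF integrable_conv[OF h f']] fourier_conv[OF h f'] mult.commute)
      then show ?thesis
        by (simp only: Suc.prems(5)) (simp add: divide_inverse algebra_simps)
    qed
    have "band V ?h" "band V ?h'"
      using Suc.prems(3,4) by (auto simp: band_def Fh Fh' mult.left_commute)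
    moreover have "fourier f' \<zeta> * fourier ?h \<zeta> = fourier f \<zeta> * fourier ?h' \<zeta>" for \<zeta>
      using Suc.prems(5)[of \<zeta>] by (simp only: Fh Fh' mult.left_commute[of _ "1 - fourier f \<zeta> / z"])
    ultimately obtain k l where kl: "integrable lborel k" "integrable lborel l" "translate_closure f f' k l"
      and le: "L1_norm (\<lambda>x. ?h x - k x) + L1_norm (\<lambda>x. ?h' x - l x) \<le> (1/2) ^ n * (L1_norm ?h + L1_norm ?h')"
      using Suc.IH[OF hi] by blast
    have "L1_norm ?h \<le> L1_norm h / 2" "L1_norm ?h' \<le> L1_norm h' / 2"
      using L1_norm_band_contraction[OF f V h hi(1) Suc.prems(3) z near Fh]
        L1_norm_band_contraction[OF f V h' hi(2) Suc.prems(4) z near Fh'] by auto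
    then have half: "(1/2) ^ n * (L1_norm ?h + L1_norm ?h') \<le> (1/2) ^ n * ((L1_norm h + L1_norm h') / 2)"
      by (intro mult_left_mono) auto
    from order_trans[OF le half] have "L1_norm (\<lambda>x. ?h x - k x) + L1_norm (\<lambda>x. ?h' x - l x) \<le> (1/2) ^ Suc n * (L1_norm h + L1_norm h')"
      by simp
    moreover have "translate_closure f f' (\<lambda>x. ?c x + k x) (\<lambda>x. ?c' x + l x)"
      using kl ci
      by (intro translate_closure_add translate_closure_cmult translate_closure_conv f f' h)
    ultimately show ?case
      using kl ci
      by (intro exI[of _ "\<lambda>x. ?c x + k x"] exI[of _ "\<lambda>x. ?c' x + l x"]) (simp add: diff_diff_eq)
  qed
  show ?thesis
  proof (rule translate_closure_limit[OF f f' h(1,2)])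
    fix e :: real assume e: "0 < e"
    have "(\<lambda>n. (1/2) ^ n * (L1_norm h + L1_norm h')) \<longlonglongrightarrow> 0 * (L1_norm h + L1_norm h')"
      by (intro tendsto_mult tendsto_const LIMSEQ_power_zero) auto
    then have "\<forall>\<^sub>F n in sequentially. (1/2) ^ n * (L1_norm h + L1_norm h') < e"
      by (rule order_tendstoD(2)) (use e in simp)
    then obtain n where "(1/2) ^ n * (L1_norm h + L1_norm h') < e"
      by (auto dest: eventually_happens)
    then show "\<exists>k l. integrable lborel k \<and> integrable lborel l \<and> translate_closure f f' k l \<and>
       L1_norm (\<lambda>x. h x - k x) + L1_norm (\<lambda>x. h' x - l x) < e"
      using approx[OF h compat, of n] by (meson le_less_trans)
  qed
qed

subsection \<open>Density of band-limited functions\<close>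

text \<open>Second differences of the absolute value telescope, leaving a trapezoid. Large
  \<open>N\<close> gives the partition of unity, \<open>N = 1\<close> the de la Vallee Poussin
  multiplier.\<close>

lemma sum_triangle:
  "(\<Sum>k\<in>{- int N..int N}. triangle (t - real_of_int k))
     = (\<bar>t + real N + 1\<bar> - \<bar>t + real N\<bar> + \<bar>t - real N - 1\<bar> - \<bar>t - real N\<bar>) / 2"
proof (induction N)
  case 0
  then show ?case by (simp add: triangle_def)
next
  case (Suc N)
  have "{- int (Suc N)..int (Suc N)} = insert (int (Suc N)) (insert (- int (Suc N)) {- int N..int N})"
    by auto
  then have "(\<Sum>k\<in>{- int (Suc N)..int (Suc N)}. triangle (t - real_of_int k))
    = triangle (t - real (Suc N)) + (triangle (t - real_of_int (- int (Suc N))) + (\<Sum>k\<in>{- int N..int N}. triangle (t - real_of_int k)))"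
    by simp
  then show ?case
    unfolding Suc.IH by (simp add: triangle_def field_simps)
qed

lemma sum_triangle_eq_1:
  "\<bar>t\<bar> \<le> real N \<Longrightarrow> (\<Sum>k\<in>{- int N..int N}. triangle (t - real_of_int k)) = 1"
  unfolding sum_triangle by (auto simp: abs_if split: if_splits)

lemma triangle_eq_0: "1 \<le> \<bar>t\<bar> \<Longrightarrow> triangle t = 0"
  by (auto simp: triangle_def abs_if split: if_splits)

text \<open>The sum of three shifted triangles is the trapezoid that is 1 up to 1 and 0 from 2 on,
  the transform of the usual difference of two Fejer kernels.\<close>

definition vallee_poussin :: "real \<Rightarrow> complex" where
  "vallee_poussin x = (\<Sum>k\<in>{-1..1::int}. dilate 1 (real_of_int k) fejer x)"

lemma integrable_vallee_poussin: "integrable lborel vallee_poussin"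
  unfolding vallee_poussin_def[abs_def]
  by (intro Bochner_Integration.integrable_sum integrable_dilate integrable_fejer) simp

lemma fourier_vallee_poussin:
  "fourier vallee_poussin t = complex_of_real (\<Sum>k\<in>{- int 1..int 1}. triangle (t - real_of_int k))"
  unfolding vallee_poussin_def[abs_def]
  by (subst fourier_sum) (simp_all only: integrable_dilate[OF zero_less_one integrable_fejer]
        fourier_dilate[OF zero_less_one integrable_fejer] fourier_fejer, simp)

lemma fourier_vallee_poussin_eq_1: "\<bar>t\<bar> \<le> 1 \<Longrightarrow> fourier vallee_poussin t = 1"
  unfolding fourier_vallee_poussin by (subst sum_triangle_eq_1) auto

lemma fourier_vallee_poussin_eq_0: "2 \<le> \<bar>t\<bar> \<Longrightarrow> fourier vallee_poussin t = 0"
  unfolding fourier_vallee_poussin sum_triangle of_real_eq_0_iff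
  by (auto simp: abs_if split: if_splits)

context
  fixes f f' :: "real \<Rightarrow> complex"
  assumes f: "integrable lborel f" and f': "integrable lborel f'"
    and nz: "\<And>\<zeta>. \<zeta> \<noteq> 0 \<Longrightarrow> fourier f \<zeta> \<noteq> 0"
begin

text \<open>Each piece \<open>conv (P k) h\<close> has its spectrum within \<open>a\<close> of the
  centre \<open>k * a\<close>, where one kernel \<open>V\<close> of bandwidth \<open>a\<close>
  allows local inversion; finitely many pieces add up to \<open>h\<close>.\<close>

lemma translate_closure_band_limited:
  assumes h: "integrable lborel h" "integrable lborel h'"
    and compat: "\<And>\<zeta>. fourier f' \<zeta> * fourier h \<zeta> = fourier f \<zeta> * fourier h' \<zeta>"
    and d: "0 < d"
    and supp: "\<And>\<zeta>. \<not> (d \<le> \<bar>\<zeta>\<bar> \<and> \<bar>\<zeta>\<bar> \<le> R) \<Longrightarrow> fourier h \<zeta> = 0 \<and> fourier h' \<zeta> = 0"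
  shows "translate_closure f f' h h'"
proof -
  \<comment> \<open>The spectrum enlarged by a margin: a triangle meeting the spectrum may be
    centred slightly outside it. The bounds \<open>a < d / 2\<close> and \<open>a \<le> 1\<close>
    keep such centres in \<open>K\<close>.\<close>
  define K where "K = {\<zeta>::real. d / 2 \<le> \<bar>\<zeta>\<bar> \<and> \<bar>\<zeta>\<bar> \<le> R + 1}"
  have "K = cball 0 (R + 1) - ball 0 (d / 2)" by (auto simp: K_def)
  then have "compact K" by (simp add: compact_diff)
  moreover have "continuous_on K (\<lambda>\<zeta>. norm (fourier f \<zeta>))"
    using continuous_on_subset[OF continuous_fourier[OF f]] by (intro continuous_on_norm) auto
  ultimately obtain m where m: "0 < m" and mK: "\<And>\<zeta>. \<zeta> \<in> K \<Longrightarrow> m \<le> norm (fourier f \<zeta>)"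
  \<comment> \<open>For small \<open>R\<close> the set is empty, no minimum is attained, and
    \<open>m = 1\<close> will do.\<close>
  proof (cases "K = {}")
    case False
    then obtain z where "z \<in> K" "\<And>\<zeta>. \<zeta> \<in> K \<Longrightarrow> norm (fourier f z) \<le> norm (fourier f \<zeta>)"
      using continuous_attains_inf[of K "\<lambda>\<zeta>. norm (fourier f \<zeta>)"] \<open>compact K\<close> \<open>continuous_on K _\<close> by blast
    moreover from this have "z \<noteq> 0" using d by (auto simp: K_def)
    ultimately show ?thesis using that nz by (metis zero_less_norm_iff)
  qed (use that[of 1] in auto)
  \<comment> \<open>One \<open>n\<close> serves all centres in \<open>K\<close>, since
    \<open>m / 2\<close> is at most half of \<open>norm (fourier f s)\<close> for every
    \<open>s\<close> there.\<close>
  have "\<forall>\<^sub>F n in sequentially. spread_error f vallee_poussin (inverse (real (Suc n))) < m / 2"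
    by (rule order_tendstoD(2)[OF tendsto_spread_error[OF f integrable_vallee_poussin]]) (use m in simp)
  moreover have "\<forall>\<^sub>F n in sequentially. inverse (real (Suc n)) < d / 2"
    by (rule order_tendstoD(2)[OF LIMSEQ_inverse_real_of_nat]) (use d in simp)
  ultimately have "\<forall>\<^sub>F n in sequentially. spread_error f vallee_poussin (inverse (real (Suc n))) < m / 2
      \<and> inverse (real (Suc n)) < d / 2"
    by (rule eventually_conj)
  then obtain n where n: "spread_error f vallee_poussin (inverse (real (Suc n))) < m / 2"
      "inverse (real (Suc n)) < d / 2"
    by (auto dest: eventually_happens)
  define a where "a = inverse (real (Suc n))"
  have a: "0 < a" "a < d / 2" "a \<le> 1"
    using n by (auto simp: a_def inverse_le_1_iff)
  \<comment> \<open>In the rescaled variable \<open>\<zeta> / a\<close> the spectrum lies in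
    \<open>[-N, N]\<close>, where the shifted triangles sum to 1.\<close>
  define N where "N = nat \<lceil>R / a\<rceil>"
  define P where "P k = dilate a (real_of_int k * a) fejer" for k :: int
  have Pi: "integrable lborel (P k)" for k
    unfolding P_def by (rule integrable_dilate[OF a(1) integrable_fejer])
  have FP: "fourier (P k) \<zeta> = triangle (\<zeta> / a - real_of_int k)" for k \<zeta>
    using a by (simp add: P_def fourier_dilate integrable_fejer fourier_fejer diff_divide_distrib)
  have sum1: "AE x in lborel. g x = (\<Sum>k\<in>{- int N..int N}. conv (P k) g x)"
    if g: "integrable lborel g" and gs: "\<And>\<zeta>. \<not> (d \<le> \<bar>\<zeta>\<bar> \<and> \<bar>\<zeta>\<bar> \<le> R) \<Longrightarrow> fourier g \<zeta> = 0" for g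
  proof (rule fourier_inject[OF g])
    show "integrable lborel (\<lambda>x. \<Sum>k\<in>{- int N..int N}. conv (P k) g x)"
      by (intro Bochner_Integration.integrable_sum integrable_conv Pi g)
    fix \<zeta>
    have "fourier (\<lambda>x. \<Sum>k\<in>{- int N..int N}. conv (P k) g x) \<zeta>
      = (\<Sum>k\<in>{- int N..int N}. fourier (P k) \<zeta> * fourier g \<zeta>)"
      by (subst fourier_sum) (simp_all add: integrable_conv Pi g fourier_conv)
    also have "\<dots> = complex_of_real (\<Sum>k\<in>{- int N..int N}. triangle (\<zeta> / a - real_of_int k)) * fourier g \<zeta>"
      by (simp add: FP sum_distrib_right)
    also have "\<dots> = fourier g \<zeta>"
    proof (cases "\<bar>\<zeta>\<bar> \<le> R")
      case True
      then have "\<bar>\<zeta> / a\<bar> \<le> R / a" using a by (simp add: divide_right_mono)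
      also have "\<dots> \<le> real N" unfolding N_def by linarith
      finally show ?thesis by (simp only: sum_triangle_eq_1) simp
    qed (use gs in auto)
    finally show "fourier g \<zeta> = fourier (\<lambda>x. \<Sum>k\<in>{- int N..int N}. conv (P k) g x) \<zeta>" ..
  qed
  have piece: "translate_closure f f' (conv (P k) h) (conv (P k) h')" for k
  proof -
    define s where "s = real_of_int k * a"
    have hi: "integrable lborel (conv (P k) h)" "integrable lborel (conv (P k) h')"
      using h by (auto intro: integrable_conv Pi)
    have Fk: "fourier (conv (P k) h) \<zeta> = triangle ((\<zeta> - s) / a) * fourier h \<zeta>"
      "fourier (conv (P k) h') \<zeta> = triangle ((\<zeta> - s) / a) * fourier h' \<zeta>" for \<zeta>
      using a by (simp_all add: fourier_conv Pi h FP s_def diff_divide_distrib)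
    show ?thesis
    proof (cases "s \<in> K")
      case True
      let ?V = "dilate a s vallee_poussin"
      have V: "integrable lborel ?V"
        by (rule integrable_dilate[OF a(1) integrable_vallee_poussin])
      \<comment> \<open>The plateau of \<open>?V\<close> is exactly the support of the triangle with
        the same centre and scale.\<close>
      have FV: "fourier ?V \<zeta> * (complex_of_real (triangle ((\<zeta> - s) / a)) * c) = triangle ((\<zeta> - s) / a) * c" for \<zeta> c
      proof (cases "\<bar>(\<zeta> - s) / a\<bar> \<le> 1")
        case True
        then show ?thesis
          by (simp only: fourier_dilate[OF a(1) integrable_vallee_poussin] fourier_vallee_poussin_eq_1) simp
      next
        case False
        then show ?thesis by (subst (1 2) triangle_eq_0) auto
      qed
      have s0: "fourier f s \<noteq> 0" using True m mK[of s] by auto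
      have "L1_norm (\<lambda>x. conv f ?V x - fourier f s * ?V x) \<le> spread_error f vallee_poussin a"
        by (rule L1_norm_conv_dilate_le[OF a(1) f integrable_vallee_poussin])
      also have "\<dots> \<le> norm (fourier f s) / 2"
        using n mK[OF True] by (simp add: a_def)
      finally have near: "L1_norm (\<lambda>x. conv f ?V x - fourier f s * ?V x) \<le> norm (fourier f s) / 2" .
      have b: "band ?V (conv (P k) h)" "band ?V (conv (P k) h')"
        unfolding band_def Fk using FV by auto
      have "fourier f' \<zeta> * fourier (conv (P k) h) \<zeta> = fourier f \<zeta> * fourier (conv (P k) h') \<zeta>" for \<zeta>
        using compat[of \<zeta>] by (simp only: Fk mult.left_commute[of _ "complex_of_real _"])
      then show ?thesis
        by (rule translate_closure_band[OF f f' V s0 near hi b])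
    next
      case False
      \<comment> \<open>A centre outside \<open>K\<close> is at distance at least \<open>a\<close>
        from the spectrum, so the piece is zero and \<open>fourier f s\<close>, possibly 0, is not
        inverted.\<close>
      have "triangle ((\<zeta> - s) / a) = 0 \<or> (fourier h \<zeta> = 0 \<and> fourier h' \<zeta> = 0)" for \<zeta>
      proof (cases "d \<le> \<bar>\<zeta>\<bar> \<and> \<bar>\<zeta>\<bar> \<le> R")
        case True
        then have "a \<le> \<bar>\<zeta> - s\<bar>" using False a by (auto simp: K_def)
        then have "1 \<le> \<bar>(\<zeta> - s) / a\<bar>" using a by simp
        then show ?thesis using triangle_eq_0 by blast
      qed (use supp in auto)
      then have "fourier (conv (P k) h) \<zeta> = 0" "fourier (conv (P k) h') \<zeta> = 0" for \<zeta>
        unfolding Fk by (metis mult_eq_0_iff of_real_0)+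
      then have "AE x in lborel. conv (P k) h x = 0" "AE x in lborel. conv (P k) h' x = 0"
        using hi by (auto intro!: fourier_eq_0D)
      then show ?thesis
        by (intro translate_closure_cong_AE[OF f f' translate_closure_zero[OF f f'] hi]) simp_all
    qed
  qed
  have "translate_closure f f' (\<lambda>x. \<Sum>k\<in>{- int N..int N}. conv (P k) h x) (\<lambda>x. \<Sum>k\<in>{- int N..int N}. conv (P k) h' x)"
    by (intro translate_closure_sum f f' piece integrable_conv Pi h)
  then show ?thesis
  proof (rule translate_closure_cong_AE[OF f f' _ h])
    show "AE x in lborel. h x = (\<Sum>k\<in>{- int N..int N}. conv (P k) h x)"
      "AE x in lborel. h' x = (\<Sum>k\<in>{- int N..int N}. conv (P k) h' x)"
      using supp by (auto intro!: sum1 h)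
  qed (intro Bochner_Integration.integrable_sum integrable_conv Pi h)+
qed

text \<open>At centre 0 the estimate for \<open>conv h V\<close> compares it with
  \<open>fourier h 0 * V\<close>, which is 0: the removed low-frequency part is itself small in
  L1.\<close>

lemma translate_closure_high_pass:
  assumes h: "integrable lborel h" "integrable lborel h'"
    and compat: "\<And>\<zeta>. fourier f' \<zeta> * fourier h \<zeta> = fourier f \<zeta> * fourier h' \<zeta>"
    and h0: "fourier h 0 = 0" "fourier h' 0 = 0"
    and supp: "\<And>\<zeta>. R < \<bar>\<zeta>\<bar> \<Longrightarrow> fourier h \<zeta> = 0 \<and> fourier h' \<zeta> = 0"
  shows "translate_closure f f' h h'"
proof (rule translate_closure_limit[OF f f' h])
  fix e :: real assume e: "0 < e"
  let ?a = "\<lambda>n. inverse (real (Suc n))"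
  have "(\<lambda>n. spread_error h vallee_poussin (?a n) + spread_error h' vallee_poussin (?a n)) \<longlonglongrightarrow> 0 + 0"
    by (intro tendsto_add tendsto_spread_error h integrable_vallee_poussin)
  then have "\<forall>\<^sub>F n in sequentially. spread_error h vallee_poussin (?a n) + spread_error h' vallee_poussin (?a n) < e"
    by (rule order_tendstoD(2)) (use e in simp)
  then obtain n where n: "spread_error h vallee_poussin (?a n) + spread_error h' vallee_poussin (?a n) < e"
    by (auto dest: eventually_happens)
  define a where "a = ?a n"
  have a: "0 < a" by (simp add: a_def)
  let ?V = "dilate a 0 vallee_poussin"
  have V: "integrable lborel ?V"
    by (rule integrable_dilate[OF a integrable_vallee_poussin])
  let ?k = "\<lambda>g x. g x - conv g ?V x"
  have ki: "integrable lborel (?k g)" if "integrable lborel g" for g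
    using that integrable_conv[OF that V] by auto
  have Fk: "fourier (?k g) \<zeta> = (1 - fourier vallee_poussin (\<zeta> / a)) * fourier g \<zeta>" if "integrable lborel g" for g \<zeta>
    using fourier_dilate[OF a integrable_vallee_poussin, of 0 \<zeta>]
    by (simp add: fourier_diff that integrable_conv[OF that V] fourier_conv[OF that V] algebra_simps)
  have "translate_closure f f' (?k h) (?k h')"
  proof (rule translate_closure_band_limited[OF ki[OF h(1)] ki[OF h(2)] _ a])
    show "fourier f' \<zeta> * fourier (?k h) \<zeta> = fourier f \<zeta> * fourier (?k h') \<zeta>" for \<zeta>
      using compat[of \<zeta>]
      by (simp only: Fk[OF h(1)] Fk[OF h(2)] mult.left_commute[of _ "1 - fourier vallee_poussin (\<zeta> / a)"])
    show "fourier (?k h) \<zeta> = 0 \<and> fourier (?k h') \<zeta> = 0" if "\<not> (a \<le> \<bar>\<zeta>\<bar> \<and> \<bar>\<zeta>\<bar> \<le> R)" for \<zeta>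
    proof (cases "\<bar>\<zeta>\<bar> \<le> R")
      case True
      then have "\<bar>\<zeta> / a\<bar> \<le> 1" using that a by simp
      then show ?thesis by (simp only: Fk[OF h(1)] Fk[OF h(2)] fourier_vallee_poussin_eq_1) simp
    next
      case False
      then show ?thesis using supp[of \<zeta>] by (simp only: Fk[OF h(1)] Fk[OF h(2)]) simp
    qed
  qed
  moreover have "L1_norm (\<lambda>x. g x - ?k g x) \<le> spread_error g vallee_poussin a"
    if "integrable lborel g" "fourier g 0 = 0" for g
    using L1_norm_conv_dilate_le[OF a that(1) integrable_vallee_poussin, of 0] that(2) by simp
  then have "L1_norm (\<lambda>x. h x - ?k h x) \<le> spread_error h vallee_poussin a"
    "L1_norm (\<lambda>x. h' x - ?k h' x) \<le> spread_error h' vallee_poussin a"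
    using h h0 by blast+
  then have "L1_norm (\<lambda>x. h x - ?k h x) + L1_norm (\<lambda>x. h' x - ?k h' x) < e"
    using n unfolding a_def by linarith
  ultimately show "\<exists>k l. integrable lborel k \<and> integrable lborel l \<and> translate_closure f f' k l \<and>
       L1_norm (\<lambda>x. h x - k x) + L1_norm (\<lambda>x. h' x - l x) < e"
    using ki[OF h(1)] ki[OF h(2)] by blast
qed

text \<open>Smoothing by a broad de la Vallee Poussin kernel makes the spectrum bounded at small
  cost. It multiplies both transforms by one factor, so compatibility and the zeros at 0
  persist.\<close>

lemma translate_closure_all:
  assumes h: "integrable lborel h" "integrable lborel h'"
    and compat: "\<And>\<zeta>. fourier f' \<zeta> * fourier h \<zeta> = fourier f \<zeta> * fourier h' \<zeta>"
    and h0: "fourier h 0 = 0" "fourier h' 0 = 0"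
  shows "translate_closure f f' h h'"
proof (rule translate_closure_limit[OF f f' h])
  fix e :: real assume e: "0 < e"
  let ?V = "\<lambda>n. dilate (real (Suc n)) 0 vallee_poussin"
  have V: "integrable lborel (?V n)" for n
    by (rule integrable_dilate[OF _ integrable_vallee_poussin]) simp
  have FV: "fourier (?V n) \<zeta> = fourier vallee_poussin (\<zeta> / real (Suc n))" for n \<zeta>
    by (subst fourier_dilate[OF _ integrable_vallee_poussin]) auto
  have lim: "(\<lambda>n. L1_norm (\<lambda>x. conv (?V n) g x - g x)) \<longlonglongrightarrow> 0" if "integrable lborel g" for g
    using approximate_identity[OF integrable_vallee_poussin that]
    by (simp only: fourier_vallee_poussin_eq_1[of 0, simplified] mult_1_left)
  have "(\<lambda>n. L1_norm (\<lambda>x. conv (?V n) h x - h x) + L1_norm (\<lambda>x. conv (?V n) h' x - h' x)) \<longlonglongrightarrow> 0 + 0"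
    by (intro tendsto_add lim h)
  then have "\<forall>\<^sub>F n in sequentially. L1_norm (\<lambda>x. conv (?V n) h x - h x) + L1_norm (\<lambda>x. conv (?V n) h' x - h' x) < e"
    by (rule order_tendstoD(2)) (use e in simp)
  then obtain n where n: "L1_norm (\<lambda>x. conv (?V n) h x - h x) + L1_norm (\<lambda>x. conv (?V n) h' x - h' x) < e"
    by (auto dest: eventually_happens)
  have "translate_closure f f' (conv (?V n) h) (conv (?V n) h')"
  proof (rule translate_closure_high_pass[OF integrable_conv[OF V h(1)] integrable_conv[OF V h(2)]])
    show "fourier f' \<zeta> * fourier (conv (?V n) h) \<zeta> = fourier f \<zeta> * fourier (conv (?V n) h') \<zeta>" for \<zeta>
      using compat[of \<zeta>] by (simp only: fourier_conv[OF V h(1)] fourier_conv[OF V h(2)] mult.left_commute[of _ "fourier (?V n) \<zeta>"])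
    show "fourier (conv (?V n) h) 0 = 0" "fourier (conv (?V n) h') 0 = 0"
      by (simp_all only: fourier_conv[OF V h(1)] fourier_conv[OF V h(2)] h0 mult_zero_right)
    show "fourier (conv (?V n) h) \<zeta> = 0 \<and> fourier (conv (?V n) h') \<zeta> = 0" if "2 * real (Suc n) < \<bar>\<zeta>\<bar>" for \<zeta>
    proof -
      have "2 \<le> \<bar>\<zeta> / real (Suc n)\<bar>" using that by (simp add: pos_le_divide_eq del: of_nat_Suc)
      then show ?thesis
        by (simp only: fourier_conv[OF V h(1)] fourier_conv[OF V h(2)] FV fourier_vallee_poussin_eq_0 mult_zero_left)
    qed
  qed
  moreover have "L1_norm (\<lambda>x. h x - conv (?V n) h x) + L1_norm (\<lambda>x. h' x - conv (?V n) h' x) < e"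
    using n by (simp add: L1_norm_def norm_minus_commute)
  ultimately show "\<exists>k l. integrable lborel k \<and> integrable lborel l \<and> translate_closure f f' k l \<and>
       L1_norm (\<lambda>x. h x - k x) + L1_norm (\<lambda>x. h' x - l x) < e"
    using integrable_conv[OF V h(1)] integrable_conv[OF V h(2)] by blast
qed

end

subsection \<open>Transfer to the Hardy space\<close>

text \<open>\<open>lebesgue\<close> is the completion of \<open>lborel\<close>, so a Lebesgue
  integrable function may be exchanged for a Borel one off a null set.\<close>

lemma L1_AE_borel:
  assumes g: "integrable lborel g" and ae: "AE x in lborel. f x = g x"
  shows "f \<in> L1" "L1_norm f = L1_norm g" "fourier f = fourier g"
proof -
  have ae': "AE x in lebesgue. g x = f x" "AE x in lebesgue. f x = g x"
    using AE_completion[OF ae] by (auto simp: eq_commute)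
  have gm: "g \<in> borel_measurable lebesgue"
    using borel_if_integrable[OF g] by (auto intro: measurable_completion)
  have fm: "f \<in> borel_measurable lebesgue"
    by (rule borel_measurable_AE[OF gm ae'(1)])
  have "integrable lebesgue g" using g borel_if_integrable[OF g] by (simp add: integrable_completion)
  then show "f \<in> L1" unfolding L1_def using integrable_cong_AE_imp[OF _ fm ae'(1)] by blast
  show "L1_norm f = L1_norm g"
    unfolding L1_norm_def using ae'(2) by (intro integral_cong_AE) (use fm gm in auto)
  have em: "(\<lambda>x. exp (\<i> * complex_of_real (x * \<zeta>))) \<in> borel_measurable lebesgue" for \<zeta>
    by (intro measurable_completion) measurable
  show "fourier f = fourier g"
  proof
    fix \<zeta>
    show "fourier f \<zeta> = fourier g \<zeta>"
      unfolding fourier_def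
    proof (rule integral_cong_AE)
      show "AE x in lebesgue. f x * exp (\<i> * complex_of_real (x * \<zeta>)) = g x * exp (\<i> * complex_of_real (x * \<zeta>))"
        using ae'(2) by eventually_elim simp
    qed (intro borel_measurable_times fm gm em)+
  qed
qed

lemma L1_borel_representative:
  assumes "f \<in> L1"
  obtains g where "integrable lborel g" "AE x in lborel. f x = g x"
proof -
  have fi: "integrable lebesgue f" using assms by (simp add: L1_def)
  have "(\<lambda>x. Re (f x)) \<in> borel_measurable lebesgue"
    using borel_measurable_integrable[OF fi] by simp
  from completion_ex_borel_measurable_real[OF this]
  obtain p where p: "p \<in> borel_measurable lborel" "AE x in lborel. Re (f x) = p x" by blast
  have "(\<lambda>x. Im (f x)) \<in> borel_measurable lebesgue"
    using borel_measurable_integrable[OF fi] by simp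
  from completion_ex_borel_measurable_real[OF this]
  obtain q where q: "q \<in> borel_measurable lborel" "AE x in lborel. Im (f x) = q x" by blast
  define g where "g x = Complex (p x) (q x)" for x
  have gm: "g \<in> borel_measurable lborel"
    using p(1) q(1) unfolding g_def Complex_eq by measurable
  have ae: "AE x in lborel. f x = g x"
    using p(2) q(2) by eventually_elim (simp add: g_def complex_eq_iff)
  have "integrable lebesgue g"
    using AE_completion[OF ae] measurable_completion[OF gm]
    by (intro integrable_cong_AE_imp[OF fi]) auto
  then have "integrable lborel g" using gm by (simp add: integrable_completion)
  with ae that show ?thesis by blast
qed

lemma L1_if_integrable_lborel: "integrable lborel g \<Longrightarrow> g \<in> L1"
  by (rule L1_AE_borel(1)) auto

lemma is_hilbert_transform_AE:
  assumes "integrable lborel g" "integrable lborel g'"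
    and "AE x in lborel. f x = g x" "AE x in lborel. f' x = g' x"
  shows "is_hilbert_transform f f' \<longleftrightarrow> is_hilbert_transform g g'"
  unfolding is_hilbert_transform_def L1_AE_borel(3)[OF assms(1,3)] L1_AE_borel(3)[OF assms(2,4)]
  using L1_AE_borel(1)[OF assms(2,4)] L1_if_integrable_lborel[OF assms(2)] by simp

lemma H1_AE_borel:
  assumes "integrable lborel g" "AE x in lborel. f x = g x" "is_hilbert_transform g g'"
  shows "f \<in> H1" "is_hilbert_transform f g'"
proof -
  show h: "is_hilbert_transform f g'"
    using assms(3) unfolding is_hilbert_transform_def L1_AE_borel(3)[OF assms(1,2)] .
  then show "f \<in> H1" using L1_AE_borel(1)[OF assms(1,2)] by (auto simp: H1_def)
qed

text \<open>Removes the choice operator: two Hilbert transforms of the same function agree almost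
  everywhere by injectivity away from 0.\<close>

lemma L1_norm_hilbert:
  assumes "is_hilbert_transform f g"
  shows "L1_norm (hilbert f) = L1_norm g"
proof -
  have h: "is_hilbert_transform f (hilbert f)"
    unfolding hilbert_def by (rule someI[of "is_hilbert_transform f", OF assms])
  obtain u where u: "integrable lborel u" "AE x in lborel. hilbert f x = u x"
    using h by (auto simp: is_hilbert_transform_def elim: L1_borel_representative)
  obtain v where v: "integrable lborel v" "AE x in lborel. g x = v x"
    using assms by (auto simp: is_hilbert_transform_def elim: L1_borel_representative)
  have "fourier u \<zeta> = fourier v \<zeta>" if "\<zeta> \<noteq> 0" for \<zeta>
    using h assms that
    by (simp add: is_hilbert_transform_def L1_AE_borel(3)[OF u, symmetric] L1_AE_borel(3)[OF v, symmetric])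
  then have "AE x in lborel. u x = v x" by (rule fourier_inject_nonzero[OF u(1) v(1)])
  then have "L1_norm u = L1_norm v" using u v by (intro L1_norm_cong_AE borel_if_integrable)
  then show ?thesis by (simp add: L1_AE_borel(2)[OF u] L1_AE_borel(2)[OF v])
qed

lemma H1_borel_representative:
  assumes "f \<in> H1"
  obtains g g' where "integrable lborel g" "integrable lborel g'"
    "AE x in lborel. f x = g x" "is_hilbert_transform g g'"
proof -
  obtain f' where f': "is_hilbert_transform f f'" and f: "f \<in> L1"
    using assms by (auto simp: H1_def)
  obtain g where g: "integrable lborel g" "AE x in lborel. f x = g x"
    using L1_borel_representative[OF f] .
  obtain g' where g': "integrable lborel g'" "AE x in lborel. f' x = g' x"
    using f' by (auto simp: is_hilbert_transform_def elim: L1_borel_representative)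
  show ?thesis
    using that[OF g(1) g'(1) g(2)] f' is_hilbert_transform_AE[OF g(1) g'(1) g(2) g'(2)] by blast
qed

lemma fourier_0_if_hilbert:
  assumes g: "integrable lborel g" and g': "integrable lborel g'" and h: "is_hilbert_transform g g'"
  shows "fourier g 0 = 0" "fourier g' 0 = 0"
proof -
  have c: "isCont (fourier g) 0" "isCont (fourier g') 0"
    using continuous_fourier[OF g] continuous_fourier[OF g']
    by (auto simp: continuous_on_eq_continuous_at)
  have r: "(fourier u \<longlongrightarrow> fourier u 0) (at_right 0)" "(fourier u \<longlongrightarrow> fourier u 0) (at_left 0)"
    if "isCont (fourier u) 0" for u
    using that by (auto simp: isCont_def intro: tendsto_within_subset)
  have "(fourier g' \<longlongrightarrow> - \<i> * fourier g 0) (at_right 0)"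
    by (rule Lim_transform_eventually[OF tendsto_mult[OF tendsto_const r(1)[OF c(1)], of "- \<i>"]])
       (auto simp: eventually_at_filter h[unfolded is_hilbert_transform_def])
  then have 1: "fourier g' 0 = - \<i> * fourier g 0"
    using tendsto_unique[OF _ r(1)[OF c(2)]] by simp
  have "(fourier g' \<longlongrightarrow> \<i> * fourier g 0) (at_left 0)"
    by (rule Lim_transform_eventually[OF tendsto_mult[OF tendsto_const r(2)[OF c(1)], of "\<i>"]])
       (auto simp: eventually_at_filter h[unfolded is_hilbert_transform_def])
  then have 2: "fourier g' 0 = \<i> * fourier g 0"
    using tendsto_unique[OF _ r(2)[OF c(2)]] by simp
  from 1 2 show "fourier g 0 = 0" "fourier g' 0 = 0" by auto
qed

section \<open>From the span of pairs to the complex span of the translates\<close>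

lemma complex_span_zero: "(\<lambda>_. 0) \<in> complex_span S"
  unfolding complex_span_def by (auto intro!: exI[of _ "{}"])

lemma complex_span_add_cmult:
  assumes "g \<in> complex_span S" "\<psi> \<in> S"
  shows "(\<lambda>x. g x + c * \<psi> x) \<in> complex_span S"
proof -
  obtain T d where T: "finite T" "T \<subseteq> S" "g = (\<lambda>x. \<Sum>\<phi>\<in>T. d \<phi> * \<phi> x)"
    using assms(1) by (auto simp: complex_span_def)
  \<comment> \<open>\<open>\<psi>\<close> may already belong to \<open>T\<close>, in which case the
    coefficients add; \<open>d\<close> is masked outside \<open>T\<close>, where its values are
    arbitrary.\<close>
  define d' where "d' \<phi> = (if \<phi> \<in> T then d \<phi> else 0) + (if \<phi> = \<psi> then c else 0)" for \<phi>
  have "(\<Sum>\<phi>\<in>insert \<psi> T. d' \<phi> * \<phi> x)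
    = (\<Sum>\<phi>\<in>insert \<psi> T. if \<phi> \<in> T then d \<phi> * \<phi> x else 0) + (\<Sum>\<phi>\<in>insert \<psi> T. if \<phi> = \<psi> then c * \<phi> x else 0)" for x
    unfolding sum.distrib[symmetric] by (intro sum.cong) (auto simp: d'_def distrib_right)
  also have "\<dots> x = g x + c * \<psi> x" for x
    using T(1) by (simp add: T(3) sum.inter_restrict[symmetric] Int_absorb1 subset_insertI
        Int_absorb2 sum.If_cases)
  finally have "(\<lambda>x. g x + c * \<psi> x) = (\<lambda>x. \<Sum>\<phi>\<in>insert \<psi> T. d' \<phi> * \<phi> x)" by auto
  then show ?thesis
    using T assms(2) unfolding complex_span_def by (auto intro!: exI[of _ "insert \<psi> T"] exI[of _ d'])
qed

text \<open>\<open>P\<close> need not be measurable, so the shift is applied to a null set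
  containing its exceptions.\<close>

lemma AE_lborel_translate:
  fixes t :: real
  assumes "AE x in lborel. P x"
  shows "AE x in lborel. P (x - t)"
proof -
  obtain N where N: "\<And>x. x \<in> space lborel - N \<Longrightarrow> P x" "N \<in> null_sets lborel"
    using AE_E3[OF assms] by blast
  have "AE x in lborel. - t + 1 * x \<notin> N"
  proof (rule AE_borel_affine)
    have [measurable]: "N \<in> sets borel" using null_setsD2[OF N(2)] by simp
    show "Measurable.pred borel (\<lambda>x. x \<notin> N)" by measurable
  qed (use AE_not_in[OF N(2)] in auto)
  then show ?thesis by eventually_elim (use N(1) in auto)
qed

lemma is_hilbert_transform_translate:
  assumes g: "integrable lborel g" and g': "integrable lborel g'" and h: "is_hilbert_transform g g'"
  shows "is_hilbert_transform (\<lambda>x. g (x - t)) (\<lambda>x. g' (x - t))"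
  using h integrable_translate[OF g'] fourier_translate[OF g] fourier_translate[OF g']
  by (auto simp: is_hilbert_transform_def intro: L1_if_integrable_lborel)

lemma is_hilbert_transform_add_cmult:
  assumes int: "integrable lborel p" "integrable lborel q" "integrable lborel u" "integrable lborel v"
    and h: "is_hilbert_transform p q" "is_hilbert_transform u v"
  shows "is_hilbert_transform (\<lambda>x. p x + c * u x) (\<lambda>x. q x + c * v x)"
  using int h
  by (auto simp: is_hilbert_transform_def fourier_add fourier_cmult algebra_simps intro!: L1_if_integrable_lborel)

text \<open>The link between the two spans: pairs built from \<open>g\<close> remain Hilbert pairs,
  and their first components represent combinations of translates of the original
  \<open>f\<close>.\<close>

lemma translate_span_representative:
  assumes g: "integrable lborel g" and g': "integrable lborel g'" and h: "is_hilbert_transform g g'"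
    and fg: "AE x in lborel. f x = g x"
    and pq: "translate_span g g' p q"
  shows "is_hilbert_transform p q \<and> (\<exists>k\<in>complex_span (range (\<lambda>t. translate t f)). AE x in lborel. k x = p x)"
  using pq
proof induction
  case zero
  show ?case
    using complex_span_zero
    by (auto simp: is_hilbert_transform_def fourier_def intro!: L1_if_integrable_lborel)
next
  case (step p q c t)
  then obtain k where k: "k \<in> complex_span (range (\<lambda>t. translate t f))" "AE x in lborel. k x = p x"
    and pq: "is_hilbert_transform p q" by auto
  have "AE x in lborel. k x + c * translate t f x = p x + c * g (x - t)"
    using k(2) AE_lborel_translate[OF fg, of t] by eventually_elim (simp add: translate_def)
  moreover have "(\<lambda>x. k x + c * translate t f x) \<in> complex_span (range (\<lambda>t. translate t f))"
    by (rule complex_span_add_cmult[OF k(1)]) auto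
  moreover have "is_hilbert_transform (\<lambda>x. p x + c * g (x - t)) (\<lambda>x. q x + c * g' (x - t))"
    using integrable_translate_span[OF g g' step.hyps] g g' h
    by (intro is_hilbert_transform_add_cmult pq is_hilbert_transform_translate)
       (auto simp: integrable_translate)
  ultimately show ?case
    by (intro conjI bexI[of _ "\<lambda>x. k x + c * translate t f x"])
qed

lemma complete_if_fourier_nonzero:
  assumes f: "f \<in> H1" and nz: "\<And>\<zeta>. \<zeta> \<noteq> 0 \<Longrightarrow> fourier f \<zeta> \<noteq> 0"
  shows "complete_in_H1 (range (\<lambda>t. translate t f))"
proof -
  obtain g g' where g: "integrable lborel g" and g': "integrable lborel g'"
    and fg: "AE x in lborel. f x = g x" and gg': "is_hilbert_transform g g'"
    using H1_borel_representative[OF f] .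
  have "translate t f \<in> H1" for t
    unfolding translate_def
    by (rule H1_AE_borel(1)[OF integrable_translate[OF g] AE_lborel_translate[OF fg]
          is_hilbert_transform_translate[OF g g' gg']])
  then have "range (\<lambda>t. translate t f) \<subseteq> H1" by auto
  moreover have "\<exists>k\<in>complex_span (range (\<lambda>t. translate t f)). H1_norm (\<lambda>x. h x - k x) < e"
    if h: "h \<in> H1" and e: "0 < e" for h e
  proof -
    obtain u v where u: "integrable lborel u" and v: "integrable lborel v"
      and hu: "AE x in lborel. h x = u x" and uv: "is_hilbert_transform u v"
      using H1_borel_representative[OF h] .
    have "translate_closure g g' u v"
    proof (rule translate_closure_all[OF g g' _ u v])
      show "fourier g \<zeta> \<noteq> 0" if "\<zeta> \<noteq> 0" for \<zeta>
        using nz[OF that] L1_AE_borel(3)[OF g fg] by simp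
      \<comment> \<open>Away from 0 both sides carry the same Hilbert multiplier; at 0 all these
        transforms vanish.\<close>
      show "fourier g' \<zeta> * fourier u \<zeta> = fourier g \<zeta> * fourier v \<zeta>" for \<zeta>
        using gg' uv fourier_0_if_hilbert[OF g g' gg']
        by (cases "\<zeta> = 0") (simp_all add: is_hilbert_transform_def)
    qed (use fourier_0_if_hilbert[OF u v uv] in auto)
    then obtain p q where pq: "translate_span g g' p q"
      and less: "L1_norm (\<lambda>x. u x - p x) + L1_norm (\<lambda>x. v x - q x) < e"
      using e unfolding translate_closure_def by blast
    obtain k where k: "k \<in> complex_span (range (\<lambda>t. translate t f))"
      and kp: "AE x in lborel. k x = p x" and hpq: "is_hilbert_transform p q"
      using translate_span_representative[OF g g' gg' fg pq] by auto
    have p: "integrable lborel p" and q: "integrable lborel q"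
      using integrable_translate_span[OF g g' pq] by auto
    have up: "integrable lborel (\<lambda>x. u x - p x)" using u p by auto
    have ae: "AE x in lborel. h x - k x = u x - p x"
      using hu kp by eventually_elim simp
    have "is_hilbert_transform (\<lambda>x. u x - p x) (\<lambda>x. v x - q x)"
      using is_hilbert_transform_add_cmult[OF u v p q uv hpq, of "-1"] by simp
    then have "L1_norm (hilbert (\<lambda>x. h x - k x)) = L1_norm (\<lambda>x. v x - q x)"
      by (intro L1_norm_hilbert H1_AE_borel(2)[OF up ae])
    then have "H1_norm (\<lambda>x. h x - k x) < e"
      using less L1_AE_borel(2)[OF up ae] by (simp add: H1_norm_def)
    with k show ?thesis by blast
  qed
  ultimately show ?thesis by (simp add: complete_in_H1_def)
qed

section \<open>Necessity: evaluation of the Fourier transform as a functional on the span\<close>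

lemma fourier_complex_span_eq_0:
  assumes "\<And>\<phi>. \<phi> \<in> S \<Longrightarrow> \<phi> \<in> L1 \<and> fourier \<phi> \<zeta> = 0" and "g \<in> complex_span S"
  shows "g \<in> L1 \<and> fourier g \<zeta> = 0"
proof -
  obtain T c where T: "finite T" "T \<subseteq> S" and g: "g = (\<lambda>x. \<Sum>\<phi>\<in>T. c \<phi> * \<phi> x)"
    using assms(2) by (auto simp: complex_span_def)
  have "\<exists>r. integrable lborel r \<and> (AE x in lborel. \<phi> x = r x)" if "\<phi> \<in> S" for \<phi>
    using assms(1)[OF that] by (auto elim: L1_borel_representative)
  then obtain r where r: "\<And>\<phi>. \<phi> \<in> S \<Longrightarrow> integrable lborel (r \<phi>)"
    and ae: "\<And>\<phi>. \<phi> \<in> S \<Longrightarrow> AE x in lborel. \<phi> x = r \<phi> x"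
    by metis
  have ri: "integrable lborel (\<lambda>x. c \<phi> * r \<phi> x)" if "\<phi> \<in> T" for \<phi>
    using r that T(2) by auto
  have "AE x in lborel. \<forall>\<phi>\<in>T. \<phi> x = r \<phi> x"
    using T ae by (auto simp: AE_finite_all)
  then have gr: "AE x in lborel. g x = (\<Sum>\<phi>\<in>T. c \<phi> * r \<phi> x)"
    unfolding g by eventually_elim simp
  have "fourier (\<lambda>x. \<Sum>\<phi>\<in>T. c \<phi> * r \<phi> x) \<zeta> = (\<Sum>\<phi>\<in>T. c \<phi> * fourier \<phi> \<zeta>)"
    using T(2) r by (subst fourier_sum[OF ri]) (auto simp: fourier_cmult L1_AE_borel(3)[OF r ae] subset_iff intro!: sum.cong)
  also have "\<dots> = 0" using assms(1) T(2) by (intro sum.neutral) auto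
  finally show ?thesis
    using L1_AE_borel[OF Bochner_Integration.integrable_sum[OF ri] gr] by simp
qed

lemma fourier_nonzero_if_complete:
  assumes f: "f \<in> H1" and comp: "complete_in_H1 (range (\<lambda>t. translate t f))" and z: "\<zeta> \<noteq> 0"
  shows "fourier f \<zeta> \<noteq> 0"
proof
  assume f0: "fourier f \<zeta> = 0"
  obtain g g' where g: "integrable lborel g" and fg: "AE x in lborel. f x = g x"
    using H1_borel_representative[OF f] by metis
  \<comment> \<open>With bandwidth \<open>\<bar>\<zeta>\<bar>\<close> the triangle around
    \<open>\<zeta>\<close> just reaches 0 and never crosses it, so the Hilbert transform of
    \<open>h\<close> is the scalar multiple by \<open>- \<i> * sgn \<zeta>\<close>.\<close>
  define h where "h = dilate \<bar>\<zeta>\<bar> \<zeta> fejer"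
  have a: "0 < \<bar>\<zeta>\<bar>" using z by simp
  have h: "integrable lborel h" unfolding h_def by (rule integrable_dilate[OF a integrable_fejer])
  have Fh: "fourier h w = triangle ((w - \<zeta>) / \<bar>\<zeta>\<bar>)" for w
    unfolding h_def fourier_dilate[OF a integrable_fejer] fourier_fejer ..
  have "is_hilbert_transform h (\<lambda>x. - \<i> * complex_of_real (sgn \<zeta>) * h x)"
    unfolding is_hilbert_transform_def
  proof (intro conjI allI impI)
    show "(\<lambda>x. - \<i> * complex_of_real (sgn \<zeta>) * h x) \<in> L1"
      using h by (intro L1_if_integrable_lborel) auto
    fix w :: real assume w: "w \<noteq> 0"
    have "w / \<bar>w\<bar> = sgn \<zeta> \<or> 1 \<le> \<bar>(w - \<zeta>) / \<bar>\<zeta>\<bar>\<bar>"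
      using w z by (auto simp: abs_if sgn_if field_simps)
    then have "complex_of_real (sgn \<zeta>) * fourier h w = complex_of_real (w / \<bar>w\<bar>) * fourier h w"
      unfolding Fh using triangle_eq_0 by fastforce
    then show "fourier (\<lambda>x. - \<i> * complex_of_real (sgn \<zeta>) * h x) w = - \<i> * complex_of_real (w / \<bar>w\<bar>) * fourier h w"
      unfolding fourier_cmult[OF h] by (simp only: mult.assoc)
  qed
  then have "h \<in> H1" by (intro H1_AE_borel(1)[OF h]) auto
  \<comment> \<open>The threshold 1 is \<open>fourier h \<zeta>\<close>, the gap to
    \<open>fourier k \<zeta> = 0\<close> that the norm would have to dominate.\<close>
  then obtain k where k: "k \<in> complex_span (range (\<lambda>t. translate t f))" and less: "H1_norm (\<lambda>x. h x - k x) < 1"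
    using comp unfolding complete_in_H1_def by (meson zero_less_one)
  have "translate t f \<in> L1 \<and> fourier (translate t f) \<zeta> = 0" for t
    using L1_AE_borel[OF integrable_translate[OF g] AE_lborel_translate[OF fg], of t]
      fourier_translate[OF g, of t \<zeta>] f0 L1_AE_borel(3)[OF g fg]
    by (simp add: translate_def)
  then have k0: "k \<in> L1 \<and> fourier k \<zeta> = 0"
    by (intro fourier_complex_span_eq_0[OF _ k]) auto
  then obtain r where r: "integrable lborel r" "AE x in lborel. k x = r x"
    by (auto elim: L1_borel_representative)
  have hr: "integrable lborel (\<lambda>x. h x - r x)" using h r by auto
  have "AE x in lborel. h x - k x = h x - r x" using r(2) by eventually_elim simp
  note hk = L1_AE_borel(2)[OF hr this]
  have "fourier r \<zeta> = 0" using k0 L1_AE_borel(3)[OF r] by simp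
  moreover have "fourier h \<zeta> = 1" by (simp add: Fh triangle_def)
  ultimately have "1 \<le> L1_norm (\<lambda>x. h x - r x)"
    using norm_fourier_le[OF hr, of \<zeta>] by (simp add: fourier_diff[OF h r(1)])
  also have "\<dots> \<le> H1_norm (\<lambda>x. h x - k x)"
    by (simp add: H1_norm_def hk)
  finally show False using less by simp
qed

theorem theorem3p6:
  fixes f :: "real \<Rightarrow> complex"
  assumes "f \<in> H1"
  shows "complete_in_H1 (range (\<lambda>t. translate t f)) \<longleftrightarrow> (\<forall>\<zeta>. \<zeta> \<noteq> 0 \<longrightarrow> fourier f \<zeta> \<noteq> 0)"
  using complete_if_fourier_nonzero[OF assms] fourier_nonzero_if_complete[OF assms] by blast

end
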